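(* Let $m,n\ge 1$ and let $\varphi=(\varphi_1,\ldots,\varphi_m):[B(\mathcal H)^n]_1\to [B(\mathcal H)^m]_1^-$ be a free holomorphic function. Then the following statements hold. (i) Either $\varphi([B(\mathcal H)^n]_1)\subseteq [B(\mathcal H)^m]_1$, or there exists $\zeta\in\partial\mathbb B_m$ such that $\varphi(X)=\zeta$ for all $X\in[B(\mathcal H)^n]_1$. (ii) $\varphi$ is constant if and only if $\|\varphi(0)\|=\|\varphi\|_\infty$. (iii) If $\varphi$ is non-constant and $\varphi_r(X):=\varphi(rX)$, $X\in[B(\mathcal H)^n]_1$, then the map $[0,1)\ni r\mapsto\|\varphi_r\|_\infty$ is strictly increasing. (iv) If $\widetilde\varphi$ is the boundary function of $\varphi$ with respect to $S_1,\ldots,S_n$, then $\varphi([B(\mathcal H)^n]_1)\subseteq[B(\mathcal H)^m]_1$ if and only if either $\widetilde\varphi=\zeta I$ for some $\zeta\in\mathbb B_m$, or $\widetilde\varphi$ is non-constant with $\|\widetilde\varphi\|\le 1$.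
   Context: $\mathcal H$ is a separable infinite dimensional complex Hilbert space and $B(\mathcal H)$ is the algebra of bounded operators on it. $\mathbb F_n^+$ is the free semigroup with generators $g_1,\ldots,g_n$ and identity $g_0$; $|g_0|=0$, $|\alpha|=k$ if $\alpha=g_{i_1}\cdots g_{i_k}$; $X_\alpha:=X_{i_1}\cdots X_{i_k}$ and $X_{g_0}:=I$. $[B(\mathcal H)^n]_1:=\{(X_1,\ldots,X_n)\in B(\mathcal H)^n:\ \|X_1X_1^*+\cdots+X_nX_n^*\|^{1/2}<1\}$, and $[B(\mathcal H)^n]_1^-$ is the closed ball ($\le 1$); the norm of $(X_1,\ldots,X_n)$ is its norm as a row operator $\mathcal H^{(n)}\to\mathcal H$. A free holomorphic function $f:[B(\mathcal H)^n]_1\to B(\mathcal H)$ is a map $f(X)=\sum_{k=0}^\infty\sum_{|\alpha|=k}a_\alpha X_\alpha$ (the series over $k$ converging in operator norm) with $a_\alpha\in\mathbb C$ and $\limsup_{k\to\infty}(\sum_{|\alpha|=k}|a_\alpha|^2)^{1/2k}\le 1$. A map $\varphi=(\varphi_1,\ldots,\varphi_m)$ is free holomorphic if each $\varphi_i$ is; $\|\varphi\|_\infty:=\sup_{X\in[B(\mathcal H)^n]_1}\|\varphi(X)\|$. $\mathbb B_m$ is the open Euclidean unit ball of $\mathbb C^m$; a point $\zeta\in\mathbb C^m$ is identified with $(\zeta_1I,\ldots,\zeta_mI)$, so $\varphi(0)$ is identified with a point of $\mathbb C^m$. $H_n$ is an $n$-dimensional Hilbert space with orthonormal basis $e_1,\ldots,e_n$,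 $F^2(H_n)=\mathbb C1\oplus\bigoplus_{k\ge1}H_n^{\otimes k}$ is the full Fock space, and $S_i\xi:=e_i\otimes\xi$, $i=1,\ldots,n$, are the left creation operators on $F^2(H_n)$. The boundary function of $\varphi$ (with respect to $S_1,\ldots,S_n$) is the row operator $\widetilde\varphi=(\widetilde\varphi_1,\ldots,\widetilde\varphi_m)$, $\widetilde\varphi_i:=\text{SOT-}\lim_{r\to1}\varphi_i(rS_1,\ldots,rS_n)$ (the limit exists for bounded $\varphi_i$); "constant" for $\widetilde\varphi$ means of the form $(c_1I,\ldots,c_mI)$ with $c_i\in\mathbb C$. *)

theory Defs
  imports "HOL-Analysis.Analysis"
begin

section \<open>Complex Hilbert spaces\<close>

text \<open>The complex inner product is linear in its first argument; the underlying real structure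
  (norm, topology, \<^const>\<open>inner\<close>) is the one of \<^class>\<open>real_inner\<close>.\<close>

class complex_hilbert_space = real_inner + banach +
  fixes scaleC :: "complex \<Rightarrow> 'a \<Rightarrow> 'a" (infixr \<open>*\<^sub>C\<close> 75)
    and cinner :: "'a \<Rightarrow> 'a \<Rightarrow> complex"
  assumes scaleC_add_right: "c *\<^sub>C (x + y) = c *\<^sub>C x + c *\<^sub>C y"
    and scaleC_add_left: "(c + d) *\<^sub>C x = c *\<^sub>C x + d *\<^sub>C x"
    and scaleC_scaleC: "c *\<^sub>C d *\<^sub>C x = (c * d) *\<^sub>C x"
    and scaleR_scaleC: "r *\<^sub>R x = complex_of_real r *\<^sub>C x"
    and cinner_commute: "cinner x y = cnj (cinner y x)"
    and cinner_add_left: "cinner (x + y) z = cinner x z + cinner y z"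
    and cinner_scaleC_left: "cinner (c *\<^sub>C x) y = c * cinner x y"
    and inner_cinner: "inner x y = Re (cinner x y)"

lemma vector_space_scaleC: "vector_space (scaleC :: complex \<Rightarrow> 'a::complex_hilbert_space \<Rightarrow> 'a)"
  by standard
    (auto simp: scaleC_add_right scaleC_add_left scaleC_scaleC
          scaleR_scaleC[of 1, simplified, symmetric])

definition infinite_dimensional :: "'a::complex_hilbert_space itself \<Rightarrow> bool" where
  "infinite_dimensional _ \<longleftrightarrow>
     (\<forall>B :: 'a set. finite B \<longrightarrow> module.span scaleC B \<noteq> UNIV)"

lemma cinner_scaleC_right:
  "cinner x (c *\<^sub>C y) = cnj c * cinner x (y::'a::complex_hilbert_space)"
  by (metis cinner_commute cinner_scaleC_left complex_cnj_mult)

lemma norm_scaleC: "norm (c *\<^sub>C x) = cmod c * norm (x::'a::complex_hilbert_space)"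
proof -
  have "cinner x x = complex_of_real (Re (cinner x x))"
    using cinner_commute[of x x] by (simp add: complex_eq_iff)
  hence im: "Im (cinner x x) = 0" by (metis Im_complex_of_real)
  have "(norm (c *\<^sub>C x))\<^sup>2 = Re (c * cnj c * cinner x x)"
    by (simp add: power2_norm_eq_inner inner_cinner cinner_scaleC_left cinner_scaleC_right
        im algebra_simps)
  also have "\<dots> = (cmod c)\<^sup>2 * (norm x)\<^sup>2"
    by (simp add: power2_norm_eq_inner[of x] inner_cinner[of x] im cmod_power2
        flip: power2_eq_square)
  finally show ?thesis
    by (metis norm_ge_zero mult_nonneg_nonneg power2_eq_imp_eq power_mult_distrib)
qed

section \<open>Bounded operators\<close>

text \<open>The type of bounded \<^emph>\<open>real\<close>-linear operators carries the operator norm;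
  \<open>B(H)\<close> is its subset of complex-linear operators.\<close>

definition bounded_ops :: "('a::complex_hilbert_space \<Rightarrow>\<^sub>L 'a) set" where
  "bounded_ops = {T. \<forall>c x. blinfun_apply T (c *\<^sub>C x) = c *\<^sub>C blinfun_apply T x}"

text \<open>\<open>c I\<close>\<close>

lift_definition scalar_op :: "complex \<Rightarrow> 'a::complex_hilbert_space \<Rightarrow>\<^sub>L 'a"
  is "\<lambda>c x. c *\<^sub>C x"
proof (rule bounded_linear_intro)
  fix c :: complex and x y :: 'a and r :: real
  show "c *\<^sub>C (x + y) = c *\<^sub>C x + c *\<^sub>C y" by (rule scaleC_add_right)
  show "c *\<^sub>C r *\<^sub>R x = r *\<^sub>R c *\<^sub>C x" by (simp add: scaleR_scaleC scaleC_scaleC mult.commute)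
  show "norm (c *\<^sub>C x) \<le> norm x * cmod c" by (simp add: norm_scaleC mult.commute)
qed

definition cadjoint :: "('a::complex_hilbert_space \<Rightarrow>\<^sub>L 'a) \<Rightarrow> 'a \<Rightarrow>\<^sub>L 'a" where
  "cadjoint T = (THE S. \<forall>x y. cinner (blinfun_apply T x) y = cinner x (blinfun_apply S y))"

text \<open>The adjoint exists, by the Riesz representation theorem.\<close>

lemma riesz_representation:
  fixes g :: "'a::{real_inner, banach} \<Rightarrow> real"
  assumes "bounded_linear g"
  shows "\<exists>z. \<forall>x. g x = inner x z"
proof -
  interpret g: bounded_linear g by fact
  define J where "J x = inner x x - 2 * g x" for x
  obtain K where K: "\<And>x. norm (g x) \<le> norm x * K" using g.bounded by blast
  have lower: "- (K\<^sup>2) \<le> J x" for x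
  proof -
    have "0 \<le> (norm x - K)\<^sup>2" by simp
    moreover have "g x \<le> norm x * K" using K[of x] by simp
    ultimately show ?thesis
      by (simp add: J_def power2_diff power2_norm_eq_inner)
  qed
  hence bdd: "bdd_below (range J)" by (intro bdd_belowI2)
  define d where "d = (INF x. J x)"
  have d: "d \<le> J x" for x unfolding d_def by (intro cINF_lower bdd) auto
  have "\<exists>x. J x < d + 1 / real (Suc n)" for n
    using cINF_less_iff[OF _ bdd, of "d + 1 / real (Suc n)"] by (auto simp: d_def)
  then obtain X where X: "\<And>n. J (X n) < d + 1 / real (Suc n)" by metis
  have par: "(norm (x - y))\<^sup>2 \<le> 2 * (J x - d) + 2 * (J y - d)" for x y
  proof -
    have "4 * J ((1/2) *\<^sub>R (x + y)) = inner (x + y) (x + y) - 4 * g x - 4 * g y"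
      by (simp add: J_def g.add g.scaleR add_divide_distrib)
    hence "(norm (x - y))\<^sup>2 = 2 * J x + 2 * J y - 4 * J ((1/2) *\<^sub>R (x + y))"
      by (simp add: J_def power2_norm_eq_inner inner_diff inner_add inner_commute)
    with d[of "(1/2) *\<^sub>R (x + y)"] show ?thesis by simp
  qed
  have "Cauchy X"
  proof (rule metric_CauchyI)
    fix e :: real assume "0 < e"
    then obtain N where N: "4 / e\<^sup>2 < real N" using reals_Archimedean2 by blast
    have *: "4 / real (Suc n) < e\<^sup>2" if "n \<ge> N" for n
    proof -
      have "4 / e\<^sup>2 < real (Suc n)" using N that by linarith
      thus ?thesis using \<open>0 < e\<close> by (simp add: field_simps del: of_nat_Suc)
    qed
    have "dist (X m) (X n) < e" if "m \<ge> N" "n \<ge> N" for m n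
    proof -
      have "(norm (X m - X n))\<^sup>2 < 2 * (1 / real (Suc m)) + 2 * (1 / real (Suc n))"
        using par[of "X m" "X n"] X[of m] X[of n] by argo
      also have "\<dots> < e\<^sup>2" using *[OF that(1)] *[OF that(2)] by argo
      finally show ?thesis using \<open>0 < e\<close> by (simp add: dist_norm power2_less_imp_less)
    qed
    thus "\<exists>M. \<forall>m\<ge>M. \<forall>n\<ge>M. dist (X m) (X n) < e" by blast
  qed
  then obtain z where z: "X \<longlonglongrightarrow> z" using Cauchy_convergent convergent_def by blast
  have "(\<lambda>n. J (X n)) \<longlonglongrightarrow> J z"
    unfolding J_def by (intro tendsto_intros z g.tendsto)
  moreover have "(\<lambda>n. d + 1 / real (Suc n)) \<longlonglongrightarrow> d + 0"
    by (intro tendsto_intros LIMSEQ_Suc[OF lim_const_over_n[of 1]])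
  ultimately have "J z \<le> d + 0"
    using X by (intro LIMSEQ_le) (auto intro: less_imp_le)
  hence min: "J z \<le> J x" for x using d[of x] by simp
  have "g h = inner h z" for h
  proof -
    define b where "b = inner h z - g h"
    have q: "0 \<le> 2 * t * b + t\<^sup>2 * inner h h" for t
      using min[of "z + t *\<^sub>R h"]
      by (simp add: J_def b_def inner_add g.add g.scaleR inner_commute power2_eq_square algebra_simps)
    show ?thesis
    proof (cases "h = 0")
      case False
      hence "0 < inner h h" by simp
      with q[of "- b / inner h h"] have "b\<^sup>2 / inner h h \<le> 0"
        by (simp add: power2_eq_square field_simps)
      with \<open>0 < inner h h\<close> have "b = 0" by (simp add: field_simps)
      thus ?thesis by (simp add: b_def)
    qed (simp add: g.zero)
  qed
  thus ?thesis by blast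
qed

lemma cinner_Im: "Im (cinner x y) = - inner (\<i> *\<^sub>C x) (y::'a::complex_hilbert_space)"
  by (simp add: inner_cinner cinner_scaleC_left)

lemma cinner_cadjoint:
  fixes T :: "'a::complex_hilbert_space \<Rightarrow>\<^sub>L 'a"
  assumes "T \<in> bounded_ops"
  shows "cinner (blinfun_apply T x) y = cinner x (blinfun_apply (cadjoint T) y)"
proof -
  have "\<exists>z. \<forall>x. inner (blinfun_apply T x) y = inner x z" for y
    by (rule riesz_representation) (intro bounded_linear_intros)
  then obtain f where f: "\<And>x y. inner (blinfun_apply T x) y = inner x (f y)" by metis
  have cf: "cinner (blinfun_apply T x) y = cinner x (f y)" for x y
  proof (rule complex_eqI)
    show "Re (cinner (blinfun_apply T x) y) = Re (cinner x (f y))"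
      using f[of x y] by (simp add: inner_cinner)
    show "Im (cinner (blinfun_apply T x) y) = Im (cinner x (f y))"
      using f[of "\<i> *\<^sub>C x" y] assms by (simp add: cinner_Im bounded_ops_def)
  qed
  have uniq: "u = v" if "\<And>x. inner x u = inner x v" for u v :: 'a
    proof -
    have "inner (u - v) (u - v) = 0" using that[of "u - v"] by (simp only: inner_diff_right)
    thus ?thesis by simp
  qed
  have "bounded_linear f"
  proof (rule bounded_linear_intro)
    show "f (u + v) = f u + f v" for u v by (rule uniq) (simp add: inner_add_right flip: f)
    show "f (r *\<^sub>R u) = r *\<^sub>R f u" for r u by (rule uniq) (simp flip: f)
    show "norm (f u) \<le> norm u * norm T" for u
    proof -
      have "norm (f u) * norm (f u) = inner (blinfun_apply T (f u)) u"
        by (simp add: f flip: power2_norm_eq_inner power2_eq_square)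
      also have "\<dots> \<le> norm (blinfun_apply T (f u)) * norm u" by (rule norm_cauchy_schwarz)
      also have "\<dots> \<le> norm T * norm (f u) * norm u"
        by (intro mult_right_mono norm_blinfun) simp
      finally have "norm (f u) * norm (f u) \<le> norm (f u) * (norm u * norm T)" by (simp add: mult_ac)
      thus ?thesis by (cases "f u = 0") auto
    qed
  qed
  hence "\<forall>x y. cinner (blinfun_apply T x) y = cinner x (blinfun_apply (Blinfun f) y)"
    by (simp add: bounded_linear_Blinfun_apply cf)
  moreover have "S = Blinfun f"
    if "\<forall>x y. cinner (blinfun_apply T x) y = cinner x (blinfun_apply S y)" for S
  proof (rule blinfun_eqI, rule uniq)
    fix y x
    show "inner x (blinfun_apply S y) = inner x (blinfun_apply (Blinfun f) y)"
      using that \<open>bounded_linear f\<close> by (simp add: inner_cinner bounded_linear_Blinfun_apply flip: cf)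
  qed
  ultimately have "\<forall>x y. cinner (blinfun_apply T x) y = cinner x (blinfun_apply (cadjoint T) y)"
    unfolding cadjoint_def by (rule theI)
  thus ?thesis by blast
qed

text \<open>The row operator \<open>H\<^sup>(\<^sup>n\<^sup>) \<rightarrow> H\<close>; the norm of \<^typ>\<open>'a^'n\<close> is the Hilbert space norm of the
  direct sum.\<close>

lift_definition row_op ::
  "('n::finite \<Rightarrow> 'a::real_normed_vector \<Rightarrow>\<^sub>L 'a) \<Rightarrow> ('a^'n) \<Rightarrow>\<^sub>L 'a"
  is "\<lambda>X v. \<Sum>i\<in>UNIV. blinfun_apply (X i) (v $ i)"
  by (intro bounded_linear_sum bounded_linear_compose[OF blinfun.bounded_linear_right]
      bounded_linear_vec_nth)

definition op_ball :: "('n::finite \<Rightarrow> 'a::complex_hilbert_space \<Rightarrow>\<^sub>L 'a) set" where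
  "op_ball = {X. (\<forall>i. X i \<in> bounded_ops) \<and>
                 sqrt (norm (\<Sum>i\<in>UNIV. X i o\<^sub>L cadjoint (X i))) < 1}"

definition op_cball :: "('n::finite \<Rightarrow> 'a::complex_hilbert_space \<Rightarrow>\<^sub>L 'a) set" where
  "op_cball = {X. (\<forall>i. X i \<in> bounded_ops) \<and>
                  sqrt (norm (\<Sum>i\<in>UNIV. X i o\<^sub>L cadjoint (X i))) \<le> 1}"

text \<open>The identification of \<open>\<zeta> \<in> \<complex>\<^sup>m\<close> with \<open>(\<zeta>\<^sub>1 I, \<dots>, \<zeta>\<^sub>m I)\<close>.\<close>

definition scalar_tuple :: "complex^'m \<Rightarrow> 'm::finite \<Rightarrow> 'a::complex_hilbert_space \<Rightarrow>\<^sub>L 'a" where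
  "scalar_tuple \<zeta> = (\<lambda>i. scalar_op (\<zeta> $ i))"

section \<open>Free holomorphic functions\<close>

text \<open>Elements of the free semigroup on \<open>n\<close> generators are words, i.e. lists over an
  \<open>n\<close>-element index type.\<close>

definition monomial ::
    "('n \<Rightarrow> 'a::real_normed_vector \<Rightarrow>\<^sub>L 'a) \<Rightarrow> 'n list \<Rightarrow> 'a \<Rightarrow>\<^sub>L 'a" where
  "monomial X \<alpha> = foldr (\<lambda>i T. X i o\<^sub>L T) \<alpha> id_blinfun"

definition homogeneous_part ::
    "('n::finite list \<Rightarrow> complex) \<Rightarrow> ('n \<Rightarrow> 'a \<Rightarrow>\<^sub>L 'a) \<Rightarrow> nat \<Rightarrow> 'a::complex_hilbert_space \<Rightarrow>\<^sub>L 'a" where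
  "homogeneous_part a X k = (\<Sum>\<alpha> | length \<alpha> = k. scalar_op (a \<alpha>) o\<^sub>L monomial X \<alpha>)"

definition free_expansion ::
    "(('n::finite \<Rightarrow> 'a \<Rightarrow>\<^sub>L 'a) \<Rightarrow> 'a::complex_hilbert_space \<Rightarrow>\<^sub>L 'a) \<Rightarrow> ('n list \<Rightarrow> complex) \<Rightarrow> bool" where
  "free_expansion f a \<longleftrightarrow>
     limsup (\<lambda>k. ereal ((\<Sum>\<alpha> | length \<alpha> = k. (cmod (a \<alpha>))\<^sup>2) powr (1 / (2 * real k)))) \<le> 1 \<and>
     (\<forall>X\<in>op_ball. homogeneous_part a X sums f X)"

definition free_holomorphic ::
    "(('n::finite \<Rightarrow> 'a \<Rightarrow>\<^sub>L 'a) \<Rightarrow> 'a::complex_hilbert_space \<Rightarrow>\<^sub>L 'a) \<Rightarrow> bool" where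
  "free_holomorphic f \<longleftrightarrow> (\<exists>a. free_expansion f a)"

definition free_holomorphic_map ::
    "(('n::finite \<Rightarrow> 'a \<Rightarrow>\<^sub>L 'a) \<Rightarrow> 'm::finite \<Rightarrow> 'a::complex_hilbert_space \<Rightarrow>\<^sub>L 'a) \<Rightarrow> bool" where
  "free_holomorphic_map \<phi> \<longleftrightarrow> (\<forall>i. free_holomorphic (\<lambda>X. \<phi> X i))"

definition sup_norm ::
    "(('n::finite \<Rightarrow> 'a \<Rightarrow>\<^sub>L 'a) \<Rightarrow> 'm::finite \<Rightarrow> 'a::complex_hilbert_space \<Rightarrow>\<^sub>L 'a) \<Rightarrow> real" where
  "sup_norm \<phi> = (SUP X\<in>op_ball. norm (row_op (\<phi> X)))"

section \<open>The full Fock space and boundary functions\<close>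

typedef 'i ell2 = "{f :: 'i \<Rightarrow> complex. (\<lambda>i. (cmod (f i))\<^sup>2) summable_on UNIV}"
  by (intro exI[of _ "\<lambda>_. 0"]) simp

setup_lifting type_definition_ell2

lemma sq_summable_add:
  fixes f g :: "'i \<Rightarrow> complex"
  assumes "(\<lambda>i. (cmod (f i))\<^sup>2) summable_on UNIV" "(\<lambda>i. (cmod (g i))\<^sup>2) summable_on UNIV"
  shows "(\<lambda>i. (cmod (f i + g i))\<^sup>2) summable_on UNIV"
proof (rule summable_on_comparison_test)
  show "(\<lambda>i. 2 * (cmod (f i))\<^sup>2 + 2 * (cmod (g i))\<^sup>2) summable_on UNIV"
    by (intro summable_on_add summable_on_cmult_right assms)
  show "(cmod (f i + g i))\<^sup>2 \<le> 2 * (cmod (f i))\<^sup>2 + 2 * (cmod (g i))\<^sup>2" for i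
  proof -
    have "(cmod (f i + g i))\<^sup>2 \<le> (cmod (f i) + cmod (g i))\<^sup>2"
      by (intro power_mono norm_triangle_ineq) simp
    also have "\<dots> \<le> 2 * (cmod (f i))\<^sup>2 + 2 * (cmod (g i))\<^sup>2"
      using sum_squares_bound[of "cmod (f i)" "cmod (g i)"] by (simp add: power2_sum)
    finally show ?thesis .
  qed
qed simp

lemma sq_summable_scale:
  fixes f :: "'i \<Rightarrow> complex"
  assumes "(\<lambda>i. (cmod (f i))\<^sup>2) summable_on UNIV"
  shows "(\<lambda>i. (cmod (c * f i))\<^sup>2) summable_on UNIV"
  using summable_on_cmult_right[OF assms, of "(cmod c)\<^sup>2"] by (simp add: norm_mult power_mult_distrib)

lemma sq_summable_prod:
  fixes f g :: "'i \<Rightarrow> complex"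
  assumes "(\<lambda>i. (cmod (f i))\<^sup>2) summable_on UNIV" "(\<lambda>i. (cmod (g i))\<^sup>2) summable_on UNIV"
  shows "(\<lambda>i. f i * cnj (g i)) summable_on UNIV"
proof (rule abs_summable_summable, rule summable_on_comparison_test)
  show "(\<lambda>i. (cmod (f i))\<^sup>2 + (cmod (g i))\<^sup>2) summable_on UNIV"
    by (intro summable_on_add assms)
  show "norm (f i * cnj (g i)) \<le> (cmod (f i))\<^sup>2 + (cmod (g i))\<^sup>2" for i
  proof -
    have "0 \<le> cmod (f i) * cmod (g i)" by simp
    thus ?thesis
      using sum_squares_bound[of "cmod (f i)" "cmod (g i)"] unfolding norm_mult complex_mod_cnj by linarith
  qed
qed simp

lemma Re_infsum_sq:
  fixes f :: "'i \<Rightarrow> complex"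
  assumes "(\<lambda>i. (cmod (f i))\<^sup>2) summable_on UNIV"
  shows "Re (\<Sum>\<^sub>\<infinity>i. f i * cnj (f i)) = (\<Sum>\<^sub>\<infinity>i. (cmod (f i))\<^sup>2)"
  using infsum_Re[OF sq_summable_prod[OF assms assms]]
  by (simp add: cmod_power2 flip: power2_eq_square)

instantiation ell2 :: (type) real_inner
begin

lift_definition zero_ell2 :: "'a ell2" is "\<lambda>_. 0" by simp
lift_definition plus_ell2 :: "'a ell2 \<Rightarrow> 'a ell2 \<Rightarrow> 'a ell2" is "\<lambda>f g i. f i + g i"
  by (rule sq_summable_add)
lift_definition minus_ell2 :: "'a ell2 \<Rightarrow> 'a ell2 \<Rightarrow> 'a ell2" is "\<lambda>f g i. f i - g i"
proof -
  fix f g :: "'a \<Rightarrow> complex"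
  assume "(\<lambda>i. (cmod (f i))\<^sup>2) summable_on UNIV" "(\<lambda>i. (cmod (g i))\<^sup>2) summable_on UNIV"
  thus "(\<lambda>i. (cmod (f i - g i))\<^sup>2) summable_on UNIV"
    using sq_summable_add[of f "\<lambda>i. - g i"] by simp
qed
lift_definition uminus_ell2 :: "'a ell2 \<Rightarrow> 'a ell2" is "\<lambda>f i. - f i" by simp
lift_definition scaleR_ell2 :: "real \<Rightarrow> 'a ell2 \<Rightarrow> 'a ell2" is "\<lambda>r f i. complex_of_real r * f i"
  by (rule sq_summable_scale)
lift_definition inner_ell2 :: "'a ell2 \<Rightarrow> 'a ell2 \<Rightarrow> real"
  is "\<lambda>f g. Re (\<Sum>\<^sub>\<infinity>i. f i * cnj (g i))" .
definition norm_ell2 :: "'a ell2 \<Rightarrow> real" where "norm_ell2 x = sqrt (inner x x)"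
definition dist_ell2 :: "'a ell2 \<Rightarrow> 'a ell2 \<Rightarrow> real" where "dist_ell2 x y = norm (x - y)"
definition sgn_ell2 :: "'a ell2 \<Rightarrow> 'a ell2" where "sgn_ell2 x = scaleR (inverse (norm x)) x"
definition uniformity_ell2 :: "('a ell2 \<times> 'a ell2) filter" where
  "uniformity_ell2 = (INF e\<in>{0 <..}. principal {(x, y). dist x y < e})"
definition open_ell2 :: "'a ell2 set \<Rightarrow> bool" where
  "open_ell2 U \<longleftrightarrow> (\<forall>x\<in>U. eventually (\<lambda>(x', y). x' = x \<longrightarrow> y \<in> U) uniformity)"

instance
proof
  fix x y z :: "'a ell2" and r s :: real
  show "x + y + z = x + (y + z)" by transfer (simp add: add.assoc)
  show "x + y = y + x" by transfer (simp add: add.commute)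
  show "0 + x = x" by transfer simp
  show "- x + x = 0" by transfer simp
  show "x - y = x + - y" by transfer simp
  show "r *\<^sub>R (x + y) = r *\<^sub>R x + r *\<^sub>R y" by transfer (simp add: algebra_simps)
  show "(r + s) *\<^sub>R x = r *\<^sub>R x + s *\<^sub>R x" by transfer (simp add: algebra_simps)
  show "r *\<^sub>R s *\<^sub>R x = (r * s) *\<^sub>R x" by transfer (simp add: algebra_simps)
  show "1 *\<^sub>R x = x" by transfer simp
  show "dist x y = norm (x - y)" by (rule dist_ell2_def)
  show "sgn x = scaleR (inverse (norm x)) x" by (rule sgn_ell2_def)
  show "uniformity = (INF e\<in>{0 <..}. principal {(x, y). dist x (y::'a ell2) < e})"
    by (rule uniformity_ell2_def)
  show "open U = (\<forall>x\<in>U. eventually (\<lambda>(x', y). x' = x \<longrightarrow> y \<in> U) uniformity)"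
    for U :: "'a ell2 set" by (rule open_ell2_def)
  show "norm x = sqrt (inner x x)" by (rule norm_ell2_def)
  show "inner x y = inner y x"
  proof transfer
    fix f g :: "'a \<Rightarrow> complex"
    have "(\<Sum>\<^sub>\<infinity>i. g i * cnj (f i)) = (\<Sum>\<^sub>\<infinity>i. cnj (f i * cnj (g i)))"
      by (rule infsum_cong) simp
    also have "\<dots> = cnj (\<Sum>\<^sub>\<infinity>i. f i * cnj (g i))" by (rule infsum_cnj)
    finally show "Re (\<Sum>\<^sub>\<infinity>i. f i * cnj (g i)) = Re (\<Sum>\<^sub>\<infinity>i. g i * cnj (f i))" by simp
  qed
  show "inner (x + y) z = inner x z + inner y z"
    by transfer (simp add: distrib_right infsum_add sq_summable_prod)
  show "inner (r *\<^sub>R x) y = r * inner x y"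
    by transfer (simp add: mult.assoc infsum_cmult_right')
  show "0 \<le> inner x x"
    by transfer (simp only: Re_infsum_sq, rule infsum_nonneg, simp)
  show "inner x x = 0 \<longleftrightarrow> x = 0"
  proof transfer
    fix f :: "'a \<Rightarrow> complex"
    assume s: "(\<lambda>i. (cmod (f i))\<^sup>2) summable_on UNIV"
    have "f = (\<lambda>_. 0)" if "(\<Sum>\<^sub>\<infinity>i. (cmod (f i))\<^sup>2) = 0"
    proof
      fix i
      have "(cmod (f i))\<^sup>2 = 0"
        by (rule nonneg_infsum_le_0D[where A = UNIV]) (use s that in auto)
      thus "f i = 0" by simp
    qed
    thus "Re (\<Sum>\<^sub>\<infinity>i. f i * cnj (f i)) = 0 \<longleftrightarrow> f = (\<lambda>_. 0)"
      by (auto simp: Re_infsum_sq[OF s])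
  qed
qed

end

lemma norm_ell2_power2: "(norm x)\<^sup>2 = (\<Sum>\<^sub>\<infinity>i. (cmod (Rep_ell2 x i))\<^sup>2)"
  using Re_infsum_sq[of "Rep_ell2 x"] Rep_ell2[of x]
  by (simp add: power2_norm_eq_inner inner_ell2.rep_eq)

lemma sum_le_norm_ell2:
  assumes "finite F"
  shows "(\<Sum>i\<in>F. (cmod (Rep_ell2 x i))\<^sup>2) \<le> (norm x)\<^sup>2"
  unfolding norm_ell2_power2 using Rep_ell2[of x] assms
  by (intro finite_sum_le_infsum) auto

instance ell2 :: (type) banach
proof
  fix X :: "nat \<Rightarrow> 'a ell2" assume "Cauchy X"
  have coord: "cmod (Rep_ell2 x i) \<le> norm x" for x :: "'a ell2" and i
    by (rule power2_le_imp_le) (use sum_le_norm_ell2[of "{i}" x] in simp_all)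
  have "Cauchy (\<lambda>n. Rep_ell2 (X n) i)" for i
  proof (rule metric_CauchyI)
    fix e :: real assume "0 < e"
    then obtain M where M: "\<And>m n. m \<ge> M \<Longrightarrow> n \<ge> M \<Longrightarrow> dist (X m) (X n) < e"
      using metric_CauchyD[OF \<open>Cauchy X\<close> \<open>0 < e\<close>] by blast
    have "dist (Rep_ell2 (X m) i) (Rep_ell2 (X n) i) \<le> dist (X m) (X n)" for m n
      using coord[of "X m - X n" i] by (simp add: dist_norm minus_ell2.rep_eq)
    thus "\<exists>M. \<forall>m\<ge>M. \<forall>n\<ge>M. dist (Rep_ell2 (X m) i) (Rep_ell2 (X n) i) < e"
      using M le_less_trans by blast
  qed
  hence "\<exists>l. (\<lambda>n. Rep_ell2 (X n) i) \<longlonglongrightarrow> l" for i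
    using Cauchy_convergent convergent_def by blast
  then obtain L where L: "\<And>i. (\<lambda>n. Rep_ell2 (X n) i) \<longlonglongrightarrow> L i" by metis
  have fin: "\<exists>M. \<forall>n\<ge>M. \<forall>F. finite F \<longrightarrow> (\<Sum>i\<in>F. (cmod (Rep_ell2 (X n) i - L i))\<^sup>2) \<le> e\<^sup>2"
    if "0 < e" for e :: real
  proof -
    obtain M where M: "\<And>m n. m \<ge> M \<Longrightarrow> n \<ge> M \<Longrightarrow> dist (X m) (X n) < e"
      using metric_CauchyD[OF \<open>Cauchy X\<close> \<open>0 < e\<close>] by blast
    have "(\<Sum>i\<in>F. (cmod (Rep_ell2 (X n) i - L i))\<^sup>2) \<le> e\<^sup>2" if "n \<ge> M" "finite F" for n F
    proof (rule LIMSEQ_le_const2)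
      show "(\<lambda>m. \<Sum>i\<in>F. (cmod (Rep_ell2 (X n) i - Rep_ell2 (X m) i))\<^sup>2)
              \<longlonglongrightarrow> (\<Sum>i\<in>F. (cmod (Rep_ell2 (X n) i - L i))\<^sup>2)"
        by (intro tendsto_intros L)
      have "(\<Sum>i\<in>F. (cmod (Rep_ell2 (X n) i - Rep_ell2 (X m) i))\<^sup>2) \<le> e\<^sup>2" if "m \<ge> M" for m
      proof -
        have "(\<Sum>i\<in>F. (cmod (Rep_ell2 (X n) i - Rep_ell2 (X m) i))\<^sup>2) \<le> (norm (X n - X m))\<^sup>2"
          using sum_le_norm_ell2[OF \<open>finite F\<close>, of "X n - X m"] by (simp add: minus_ell2.rep_eq)
        also have "\<dots> \<le> e\<^sup>2"
          using M[OF \<open>n \<ge> M\<close> that] by (intro power_mono) (auto simp: dist_norm)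
        finally show ?thesis .
      qed
      thus "\<exists>N. \<forall>m\<ge>N. (\<Sum>i\<in>F. (cmod (Rep_ell2 (X n) i - Rep_ell2 (X m) i))\<^sup>2) \<le> e\<^sup>2" by blast
    qed
    thus ?thesis by blast
  qed
  have diff: "(\<lambda>i. (cmod (Rep_ell2 (X n) i - L i))\<^sup>2) summable_on UNIV"
    if "\<forall>F. finite F \<longrightarrow> (\<Sum>i\<in>F. (cmod (Rep_ell2 (X n) i - L i))\<^sup>2) \<le> e\<^sup>2" for n and e :: real
    using that by (intro nonneg_bdd_above_summable_on bdd_aboveI2[where M = "e\<^sup>2"]) auto
  obtain M where M: "\<forall>n\<ge>M. \<forall>F. finite F \<longrightarrow> (\<Sum>i\<in>F. (cmod (Rep_ell2 (X n) i - L i))\<^sup>2) \<le> 1\<^sup>2"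
    using fin[OF zero_less_one] by blast
  have "(\<lambda>i. (cmod (L i - Rep_ell2 (X M) i))\<^sup>2) summable_on UNIV"
    using diff[OF M[THEN spec, THEN mp, OF order_refl]]
    by (subst norm_minus_commute)
  hence "(\<lambda>i. (cmod (L i - Rep_ell2 (X M) i + Rep_ell2 (X M) i))\<^sup>2) summable_on UNIV"
    by (rule sq_summable_add) (use Rep_ell2[of "X M"] in simp)
  hence "(\<lambda>i. (cmod (L i))\<^sup>2) summable_on UNIV" by simp
  then obtain x where x: "Rep_ell2 x = L" using Abs_ell2_inverse by blast
  have "X \<longlonglongrightarrow> x"
  proof (rule metric_LIMSEQ_I)
    fix e :: real assume "0 < e"
    then obtain M where M: "\<forall>n\<ge>M. \<forall>F. finite F \<longrightarrow>
        (\<Sum>i\<in>F. (cmod (Rep_ell2 (X n) i - L i))\<^sup>2) \<le> (e/2)\<^sup>2"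
      using fin[of "e/2"] by (meson half_gt_zero)
    have "dist (X n) x < e" if "n \<ge> M" for n
    proof -
      have b: "\<forall>F. finite F \<longrightarrow> (\<Sum>i\<in>F. (cmod (Rep_ell2 (X n) i - L i))\<^sup>2) \<le> (e/2)\<^sup>2"
        using M that by blast
      have "(norm (X n - x))\<^sup>2 = (\<Sum>\<^sub>\<infinity>i. (cmod (Rep_ell2 (X n) i - L i))\<^sup>2)"
        by (simp add: norm_ell2_power2 minus_ell2.rep_eq x)
      also have "\<dots> \<le> (e/2)\<^sup>2"
        by (rule infsum_le_finite_sums[OF diff[OF b]]) (rule b[rule_format])
      finally have "norm (X n - x) \<le> e/2" by (rule power2_le_imp_le) (use \<open>0 < e\<close> in simp)
      thus ?thesis using \<open>0 < e\<close> by (simp add: dist_norm)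
    qed
    thus "\<exists>M. \<forall>n\<ge>M. dist (X n) x < e" by blast
  qed
  thus "convergent X" by (rule convergentI)
qed

instantiation ell2 :: (type) complex_hilbert_space
begin

lift_definition scaleC_ell2 :: "complex \<Rightarrow> 'a ell2 \<Rightarrow> 'a ell2" is "\<lambda>c f i. c * f i"
  by (rule sq_summable_scale)
lift_definition cinner_ell2 :: "'a ell2 \<Rightarrow> 'a ell2 \<Rightarrow> complex"
  is "\<lambda>f g. \<Sum>\<^sub>\<infinity>i. f i * cnj (g i)" .

instance
proof
  fix x y z :: "'a ell2" and c d :: complex and r :: real
  show "c *\<^sub>C (x + y) = c *\<^sub>C x + c *\<^sub>C y" by transfer (simp add: algebra_simps)
  show "(c + d) *\<^sub>C x = c *\<^sub>C x + d *\<^sub>C x" by transfer (simp add: algebra_simps)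
  show "c *\<^sub>C d *\<^sub>C x = (c * d) *\<^sub>C x" by transfer (simp add: algebra_simps)
  show "r *\<^sub>R x = complex_of_real r *\<^sub>C x" by transfer simp
  show "cinner x y = cnj (cinner y x)"
    by transfer (simp flip: infsum_cnj add: mult.commute)
  show "cinner (x + y) z = cinner x z + cinner y z"
    by transfer (simp add: distrib_right infsum_add sq_summable_prod)
  show "cinner (c *\<^sub>C x) y = c * cinner x y"
    by transfer (simp add: mult.assoc infsum_cmult_right')
  show "inner x y = Re (cinner x y)" by transfer simp
qed

end

text \<open>With \<open>H\<^sub>n = \<complex>\<^sup>n\<close>, the tensors \<open>e\<^sub>\<alpha> = e\<^bsub>i\<^sub>1\<^esub> \<otimes> \<dots> \<otimes> e\<^bsub>i\<^sub>k\<^esub>\<close> indexed by the words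
  \<open>\<alpha> = g\<^bsub>i\<^sub>1\<^esub> \<dots> g\<^bsub>i\<^sub>k\<^esub>\<close> of length \<open>k\<close> form an orthonormal basis of the \<open>k\<close>-th tensor power,
  and the empty word gives the vacuum vector \<open>1\<close>. In these coordinates
  the full Fock space is the space of square-summable families indexed by words.\<close>

type_synonym 'n fock = "'n list ell2"

lift_definition fock_basis :: "'n list \<Rightarrow> 'n fock" is "\<lambda>\<alpha> \<beta>. if \<beta> = \<alpha> then 1 else 0"
proof -
  fix \<alpha> :: "'n list"
  have "(\<lambda>\<beta>. (cmod (if \<beta> = \<alpha> then 1 else 0))\<^sup>2) summable_on UNIV \<longleftrightarrow>
        (\<lambda>\<beta>. (cmod (if \<beta> = \<alpha> then 1 else 0))\<^sup>2) summable_on {\<alpha>}"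
    by (rule summable_on_cong_neutral) auto
  thus "(\<lambda>\<beta>. (cmod (if \<beta> = \<alpha> then 1 else 0))\<^sup>2) summable_on UNIV" by simp
qed

text \<open>The left creation operator \<open>\<xi> \<mapsto> e\<^sub>i \<otimes> \<xi>\<close>: the coefficient of \<open>e\<^sub>i \<otimes> \<xi>\<close> at the word
  \<open>g\<^sub>i \<beta>\<close> is that of \<open>\<xi>\<close> at \<open>\<beta>\<close>, and all others vanish.\<close>

definition creation_coords :: "'n \<Rightarrow> ('n list \<Rightarrow> complex) \<Rightarrow> 'n list \<Rightarrow> complex" where
  "creation_coords i f \<alpha> = (case \<alpha> of [] \<Rightarrow> 0 | j # \<beta> \<Rightarrow> if j = i then f \<beta> else 0)"

lemma creation_coords_has_sum:
  assumes "((\<lambda>\<alpha>. (cmod (f \<alpha>))\<^sup>2) has_sum s) UNIV"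
  shows "((\<lambda>\<alpha>. (cmod (creation_coords i f \<alpha>))\<^sup>2) has_sum s) UNIV"
proof -
  have "((\<lambda>\<alpha>. (cmod (creation_coords i f \<alpha>))\<^sup>2) has_sum s) (range ((#) i))"
    using assms by (subst has_sum_reindex) (auto simp: o_def creation_coords_def)
  moreover have "((\<lambda>\<alpha>. (cmod (creation_coords i f \<alpha>))\<^sup>2) has_sum s) UNIV \<longleftrightarrow>
      ((\<lambda>\<alpha>. (cmod (creation_coords i f \<alpha>))\<^sup>2) has_sum s) (range ((#) i))"
    by (rule has_sum_cong_neutral) (auto simp: creation_coords_def split: list.splits)
  ultimately show ?thesis by simp
qed

lift_definition creation_fun :: "'n \<Rightarrow> 'n fock \<Rightarrow> 'n fock" is creation_coords
  unfolding summable_on_def by (blast intro: creation_coords_has_sum)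

lemma norm_creation_fun: "norm (creation_fun i x) = norm x"
proof -
  have "((\<lambda>\<alpha>. (cmod (Rep_ell2 x \<alpha>))\<^sup>2) has_sum (norm x)\<^sup>2) UNIV"
    using Rep_ell2[of x] by (simp add: norm_ell2_power2)
  from infsumI[OF creation_coords_has_sum[OF this, of i]]
  have "(norm (creation_fun i x))\<^sup>2 = (norm x)\<^sup>2"
    by (simp add: norm_ell2_power2 creation_fun.rep_eq)
  thus ?thesis by simp
qed

lift_definition creation :: "'n \<Rightarrow> 'n fock \<Rightarrow>\<^sub>L 'n fock" is creation_fun
proof (rule bounded_linear_intro)
  fix i :: 'n and x y :: "'n fock" and r :: real
  show "creation_fun i (x + y) = creation_fun i x + creation_fun i y"
    by transfer (auto simp: creation_coords_def split: list.splits)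
  show "creation_fun i (r *\<^sub>R x) = r *\<^sub>R creation_fun i x"
    by transfer (auto simp: creation_coords_def split: list.splits)
  show "norm (creation_fun i x) \<le> norm x * 1" by (simp add: norm_creation_fun)
qed

lemma creation_fock_basis: "blinfun_apply (creation i) (fock_basis \<alpha>) = fock_basis (i # \<alpha>)"
  by (simp add: creation.rep_eq, transfer) (auto simp: creation_coords_def split: list.splits)

lemma creation_in_bounded_ops: "creation i \<in> bounded_ops"
  unfolding bounded_ops_def creation.rep_eq mem_Collect_eq
  by transfer (auto simp: creation_coords_def split: list.splits)

text \<open>The coefficients of a free holomorphic function are uniquely determined when the Hilbert
  space is infinite dimensional; they allow its evaluation at tuples of operators on another
  Hilbert space.\<close>

definition free_coeff ::
    "(('n::finite \<Rightarrow> 'a \<Rightarrow>\<^sub>L 'a) \<Rightarrow> 'a::complex_hilbert_space \<Rightarrow>\<^sub>L 'a) \<Rightarrow> 'n list \<Rightarrow> complex" where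
  "free_coeff f = (SOME a. free_expansion f a)"

definition free_series ::
    "('n::finite list \<Rightarrow> complex) \<Rightarrow> ('n \<Rightarrow> 'a \<Rightarrow>\<^sub>L 'a) \<Rightarrow> 'a::complex_hilbert_space \<Rightarrow>\<^sub>L 'a" where
  "free_series a X = (\<Sum>k. homogeneous_part a X k)"

definition boundary_function ::
    "(('n::finite \<Rightarrow> 'a \<Rightarrow>\<^sub>L 'a) \<Rightarrow> 'm::finite \<Rightarrow> 'a::complex_hilbert_space \<Rightarrow>\<^sub>L 'a)
      \<Rightarrow> 'm \<Rightarrow> 'n fock \<Rightarrow>\<^sub>L 'n fock" where
  "boundary_function \<phi> i =
     (THE T. limitin strong_operator_topology
        (\<lambda>r. free_series (free_coeff (\<lambda>X. \<phi> X i)) (\<lambda>j. r *\<^sub>R creation j)) T (at_left (1::real)))"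

end

theory Submission
  imports Defs "HOL-Complex_Analysis.Riemann_Mapping"
begin

no_notation fps_nth (infixl "$" 75)

text \<open>For \<open>X\<close> in the ball and vectors \<open>v\<close>, \<open>y\<close>, the function \<open>z \<mapsto> \<langle>\<phi>(z X) v, y\<rangle>\<close> is holomorphic on
  the unit disc, so (i)--(iii) reduce to scalar facts. If \<open>\<parallel>\<phi>(0)\<parallel> < M\<close>, where \<open>M\<close> bounds \<open>\<parallel>\<phi>\<parallel>\<close>, the Schwarz--Pick
  inequality bounds \<open>\<parallel>\<phi>(z X)\<parallel>\<close> by \<open>c M\<close> with \<open>c < 1\<close> depending only on \<open>\<parallel>\<phi>(0)\<parallel> / M\<close> and \<open>\<bar>z\<bar>\<close>. If
  \<open>\<parallel>\<phi>(0)\<parallel> = M\<close>, the maximum modulus principle forces \<open>\<phi>(X)\<^sup>* u = \<phi>(0)\<^sup>* u\<close> for all \<open>u\<close>.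

  For (iv), an isometry \<open>V\<close> of the Fock space into \<open>H\<close> gives \<open>\<phi>(r S) = V\<^sup>* \<phi>(r V S V\<^sup>* ) V\<close>, so \<open>\<phi>(r S)\<close> is
  a row contraction. It converges strongly as \<open>r \<rightarrow> 1\<close> because it converges on the vacuum vector (its
  coefficients are square summable) and commutes with the right shifts. The limit maps the vacuum
  vector to the family of coefficients, hence it is scalar exactly when \<open>\<phi>\<close> is constant.\<close>

section \<open>Operators on complex Hilbert spaces\<close>

lemma cinner_zero_left [simp]: "cinner 0 (y :: 'a::complex_hilbert_space) = 0"
  using cinner_add_left[of 0 0 y] by simp

lemma cinner_self: "cinner x x = complex_of_real ((norm (x :: 'a::complex_hilbert_space))\<^sup>2)"
proof -
  have "Im (cinner x x) = 0"
    using arg_cong[OF cinner_commute[of x x], of Im] by simp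
  thus ?thesis
    by (simp add: complex_eq_iff power2_norm_eq_inner inner_cinner)
qed

text \<open>Multiplying \<open>x\<close> by a unimodular scalar makes the complex product real and
  nonnegative, where the real inequality applies.\<close>

lemma cinner_cauchy_schwarz: "cmod (cinner x y) \<le> norm x * norm (y :: 'a::complex_hilbert_space)"
proof (cases "cinner x y = 0")
  case False
  define c where "c = cnj (sgn (cinner x y))"
  have c: "cmod c = 1" using False by (simp add: c_def norm_sgn)
  have "c * cinner x y = cinner x y * cnj (cinner x y) / complex_of_real (cmod (cinner x y))"
    by (simp add: c_def sgn_eq)
  also have "\<dots> = complex_of_real (cmod (cinner x y))"
    using False by (simp add: power2_eq_square flip: complex_norm_square)
  finally have "c * cinner x y = complex_of_real (cmod (cinner x y))" .
  hence "cmod (cinner x y) = inner (c *\<^sub>C x) y"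
    by (simp add: inner_cinner cinner_scaleC_left)
  also have "\<dots> \<le> norm x * norm y"
    using norm_cauchy_schwarz[of "c *\<^sub>C x" y] by (simp add: norm_scaleC c)
  finally show ?thesis .
qed simp

lemma bounded_linear_cinner_left: "bounded_linear (\<lambda>x. cinner x (y :: 'a::complex_hilbert_space))"
  by (rule bounded_linear_intro[where K = "norm y"])
    (simp_all add: cinner_add_left scaleR_scaleC cinner_scaleC_left cinner_cauchy_schwarz scaleR_conv_of_real)

lemma inner_scaleC: "inner (c *\<^sub>C x) y = inner x (cnj c *\<^sub>C (y :: 'a::complex_hilbert_space))"
  by (simp add: inner_cinner cinner_scaleC_left cinner_scaleC_right)

lemma scaleC_zero_left [simp]: "0 *\<^sub>C (x :: 'a::complex_hilbert_space) = 0"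
  using scaleR_scaleC[of 0 x] by simp

lemma scaleC_one [simp]: "1 *\<^sub>C (x :: 'a::complex_hilbert_space) = x"
  using scaleR_scaleC[of 1 x] by simp

lemma scaleC_zero_right [simp]: "c *\<^sub>C (0 :: 'a::complex_hilbert_space) = 0"
  using scalar_op.rep_eq[of c, symmetric] by (metis blinfun.zero_right)

lemma scaleC_scaleR: "c *\<^sub>C r *\<^sub>R x = r *\<^sub>R c *\<^sub>C (x :: 'a::complex_hilbert_space)"
  by (simp add: scaleR_scaleC scaleC_scaleC mult.commute)

lemma scaleC_sum: "c *\<^sub>C (\<Sum>i\<in>A. f i) = (\<Sum>i\<in>A. c *\<^sub>C (f i :: 'a::complex_hilbert_space))"
  by (induction A rule: infinite_finite_induct) (auto simp: scaleC_add_right)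

text \<open>On the zero space all scalar tuples coincide; a nonzero vector is what makes their norms
  and entries recoverable.\<close>

lemma ex_nonzero: "infinite_dimensional TYPE('a::complex_hilbert_space) \<Longrightarrow> \<exists>x :: 'a. x \<noteq> 0"
proof (rule ccontr)
  assume "infinite_dimensional TYPE('a)" and "\<not> (\<exists>x :: 'a. x \<noteq> 0)"
  hence "(UNIV :: 'a set) = {0}" by auto
  moreover interpret vector_space "scaleC :: complex \<Rightarrow> 'a \<Rightarrow> 'a" by (rule vector_space_scaleC)
  have "span {} = {0 :: 'a}" by simp
  ultimately show False
    using \<open>infinite_dimensional TYPE('a)\<close> unfolding infinite_dimensional_def by (metis finite.emptyI)
qed

section \<open>Adjoints between Hilbert spaces and the norm of an operator times its adjoint\<close>

lemma real_adjoint_exists: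
  fixes T :: "'a::{real_inner, banach} \<Rightarrow>\<^sub>L 'b::real_inner"
  shows "\<exists>S :: 'b \<Rightarrow>\<^sub>L 'a. \<forall>x y. inner (blinfun_apply T x) y = inner x (blinfun_apply S y)"
proof -
  have "\<exists>z. \<forall>x. inner (blinfun_apply T x) y = inner x z" for y
    by (rule riesz_representation) (intro bounded_linear_intros)
  then obtain f where f: "\<And>x y. inner (blinfun_apply T x) y = inner x (f y)" by metis
  have uniq: "u = v" if "\<And>x. inner x u = inner x v" for u v :: 'a
    using that by (metis vector_eq_ldot)
  have "bounded_linear f"
  proof (rule bounded_linear_intro)
    show "f (u + v) = f u + f v" for u v by (rule uniq) (simp add: inner_add_right flip: f)
    show "f (r *\<^sub>R u) = r *\<^sub>R f u" for r u by (rule uniq) (simp flip: f)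
    show "norm (f u) \<le> norm u * norm T" for u
    proof -
      have "norm (f u) * norm (f u) = inner (blinfun_apply T (f u)) u"
        by (simp add: f flip: power2_norm_eq_inner power2_eq_square)
      also have "\<dots> \<le> norm (blinfun_apply T (f u)) * norm u" by (rule norm_cauchy_schwarz)
      also have "\<dots> \<le> norm T * norm (f u) * norm u"
        by (intro mult_right_mono norm_blinfun) simp
      finally have "norm (f u) * norm (f u) \<le> norm (f u) * (norm u * norm T)" by (simp add: mult_ac)
      thus ?thesis by (cases "f u = 0") auto
    qed
  qed
  thus ?thesis using f by (metis bounded_linear_Blinfun_apply)
qed

text \<open>\<^const>\<open>cadjoint\<close> only covers endomorphisms. Rows and maps into the Fock space need adjoints
  between different spaces; on complex-linear maps the adjoint for the real inner product agrees with
  the complex one.\<close>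

definition real_adjoint :: "('a::{real_inner, banach} \<Rightarrow>\<^sub>L 'b::real_inner) \<Rightarrow> 'b \<Rightarrow>\<^sub>L 'a" where
  "real_adjoint T = (SOME S. \<forall>x y. inner (blinfun_apply T x) y = inner x (blinfun_apply S y))"

lemma inner_real_adjoint:
  "inner (blinfun_apply T x) y = inner x (blinfun_apply (real_adjoint T) y)"
  unfolding real_adjoint_def using someI_ex[OF real_adjoint_exists[of T]] by blast

lemma norm_adjoint_le:
  fixes T :: "'a::{real_inner, banach} \<Rightarrow>\<^sub>L 'b::real_inner"
  assumes adj: "\<And>x y. inner (blinfun_apply T x) y = inner x (blinfun_apply S y)"
  shows "norm (blinfun_apply S y) \<le> norm T * norm y"
proof -
  have "norm (blinfun_apply S y) * norm (blinfun_apply S y) = inner (blinfun_apply T (blinfun_apply S y)) y"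
    by (simp add: adj flip: power2_norm_eq_inner power2_eq_square)
  also have "\<dots> \<le> norm (blinfun_apply T (blinfun_apply S y)) * norm y" by (rule norm_cauchy_schwarz)
  also have "\<dots> \<le> norm T * norm (blinfun_apply S y) * norm y"
    by (intro mult_right_mono norm_blinfun) simp
  finally have "norm (blinfun_apply S y) * norm (blinfun_apply S y)
      \<le> norm (blinfun_apply S y) * (norm T * norm y)" by (simp add: mult_ac)
  thus ?thesis by (cases "blinfun_apply S y = 0") auto
qed

text \<open>The C*-identity. Since \<open>S\<close> is no larger than \<open>T\<close>, one
  inequality is submultiplicativity. For the other, the square of the norm of \<open>S y\<close> is
  the product of \<open>T (S y)\<close> with \<open>y\<close>, which bounds \<open>S\<close> by the
  square root of the norm of \<open>T o\<^sub>L S\<close>; duality carries this bound over to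
  \<open>T\<close>.\<close>

lemma norm_compose_adjoint:
  fixes T :: "'a::{real_inner, banach} \<Rightarrow>\<^sub>L 'b::real_inner"
  assumes adj: "\<And>x y. inner (blinfun_apply T x) y = inner x (blinfun_apply S y)"
  shows "norm (T o\<^sub>L S) = (norm T)\<^sup>2"
proof (rule antisym)
  have "norm (blinfun_apply S y) \<le> norm T * norm y" for y
    using adj by (rule norm_adjoint_le)
  hence "norm S \<le> norm T" by (intro norm_blinfun_bound) auto
  hence "norm T * norm S \<le> norm T * norm T" by (simp add: mult_left_mono)
  thus "norm (T o\<^sub>L S) \<le> (norm T)\<^sup>2"
    using norm_blinfun_compose[of T S] by (simp add: power2_eq_square)
  have SS: "norm (blinfun_apply S y) \<le> sqrt (norm (T o\<^sub>L S)) * norm y" for y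
  proof -
    have "(norm (blinfun_apply S y))\<^sup>2 = inner (blinfun_apply (T o\<^sub>L S) y) y"
      by (simp add: adj power2_norm_eq_inner)
    also have "\<dots> \<le> norm (blinfun_apply (T o\<^sub>L S) y) * norm y" by (rule norm_cauchy_schwarz)
    also have "\<dots> \<le> norm (T o\<^sub>L S) * norm y * norm y"
      by (intro mult_right_mono norm_blinfun) simp
    finally have "(norm (blinfun_apply S y))\<^sup>2 \<le> (sqrt (norm (T o\<^sub>L S)) * norm y)\<^sup>2"
      by (simp add: power_mult_distrib power2_eq_square[of "norm y"] mult.assoc)
    thus ?thesis by (rule power2_le_imp_le) simp
  qed
  have "norm (blinfun_apply T x) \<le> sqrt (norm (T o\<^sub>L S)) * norm x" for x
  proof -
    have "norm (blinfun_apply T x) * norm (blinfun_apply T x)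
        = inner x (blinfun_apply S (blinfun_apply T x))"
      by (simp flip: adj power2_norm_eq_inner power2_eq_square)
    also have "\<dots> \<le> norm x * norm (blinfun_apply S (blinfun_apply T x))" by (rule norm_cauchy_schwarz)
    also have "\<dots> \<le> norm x * (sqrt (norm (T o\<^sub>L S)) * norm (blinfun_apply T x))"
      by (intro mult_left_mono SS) simp
    finally have "norm (blinfun_apply T x) * norm (blinfun_apply T x)
      \<le> norm (blinfun_apply T x) * (sqrt (norm (T o\<^sub>L S)) * norm x)" by (simp add: mult_ac)
    thus ?thesis by (cases "blinfun_apply T x = 0") auto
  qed
  hence "norm T \<le> sqrt (norm (T o\<^sub>L S))" by (intro norm_blinfun_bound) auto
  hence "(norm T)\<^sup>2 \<le> (sqrt (norm (T o\<^sub>L S)))\<^sup>2" by (intro power_mono) auto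
  thus "(norm T)\<^sup>2 \<le> norm (T o\<^sub>L S)" by simp
qed

section \<open>Row operators and the operator balls\<close>

lemma norm_vec_power2: "(norm v)\<^sup>2 = (\<Sum>i\<in>UNIV. (norm (v $ i))\<^sup>2)"
  for v :: "'a::real_normed_vector ^ 'n::finite"
  by (simp add: norm_vec_def L2_set_def sum_nonneg)

lemma sum_axis: "(\<Sum>i\<in>UNIV. f i (axis j x $ i)) = f j x"
  if "\<And>i. f i 0 = (0 :: 'b::comm_monoid_add)"
  by (subst sum.mono_neutral_right[of _ "{j}"]) (auto simp: axis_def that)

lemma row_op_axis: "blinfun_apply (row_op X) (axis i x) = blinfun_apply (X i) x"
  unfolding row_op.rep_eq by (rule sum_axis) (simp add: blinfun.zero_right)

text \<open>The adjoint of the row has the components \<open>cadjoint (X i)\<close>, so the sum is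
  the row times its adjoint and the C*-identity applies. This replaces the expression defining the
  balls by a row norm.\<close>

lemma norm_sum_compose_cadjoint:
  fixes X :: "'n::finite \<Rightarrow> 'a::complex_hilbert_space \<Rightarrow>\<^sub>L 'a"
  assumes X: "\<And>i. X i \<in> bounded_ops"
  shows "norm (\<Sum>i\<in>UNIV. X i o\<^sub>L cadjoint (X i)) = (norm (row_op X))\<^sup>2"
proof -
  define S where "S = real_adjoint (row_op X)"
  have adj: "inner (blinfun_apply (row_op X) x) y = inner x (blinfun_apply S y)" for x y
    unfolding S_def by (rule inner_real_adjoint)
  have comp: "blinfun_apply S y $ i = blinfun_apply (cadjoint (X i)) y" for i y
  proof -
    have "inner x (blinfun_apply S y $ i) = inner x (blinfun_apply (cadjoint (X i)) y)" for x
    proof -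
      have "inner x (blinfun_apply S y $ i) = inner (axis i x) (blinfun_apply S y)"
        unfolding inner_vec_def
        using sum_axis[of "\<lambda>j t. inner t (blinfun_apply S y $ j)" i x] by simp
      also have "\<dots> = inner (blinfun_apply (X i) x) y"
        by (simp add: row_op_axis flip: adj)
      finally show ?thesis by (simp add: inner_cinner cinner_cadjoint[OF X])
    qed
    thus ?thesis by (metis vector_eq_ldot)
  qed
  have "(\<Sum>i\<in>UNIV. X i o\<^sub>L cadjoint (X i)) = row_op X o\<^sub>L S"
    by (rule blinfun_eqI) (simp add: row_op.rep_eq comp blinfun.sum_left)
  thus ?thesis using norm_compose_adjoint[OF adj] by simp
qed

lemma op_ball_iff: "X \<in> op_ball \<longleftrightarrow> (\<forall>i. X i \<in> bounded_ops) \<and> norm (row_op X) < 1"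
  unfolding op_ball_def by (auto simp: norm_sum_compose_cadjoint abs_square_less_1 abs_square_le_1)

lemma op_cball_iff: "X \<in> op_cball \<longleftrightarrow> (\<forall>i. X i \<in> bounded_ops) \<and> norm (row_op X) \<le> 1"
  unfolding op_cball_def by (auto simp: norm_sum_compose_cadjoint abs_square_less_1 abs_square_le_1)

lemma row_op_scaleR: "row_op (\<lambda>i. r *\<^sub>R X i) = r *\<^sub>R row_op X"
  by (rule blinfun_eqI) (simp add: row_op.rep_eq blinfun.scaleR_left scaleR_sum_right)

lemma row_op_scalar_op_compose: "row_op (\<lambda>i. scalar_op c o\<^sub>L X i) = scalar_op c o\<^sub>L row_op X"
  by (rule blinfun_eqI) (simp add: row_op.rep_eq scalar_op.rep_eq scaleC_sum)

text \<open>The lower bound is the upper bound applied to \<open>inverse c\<close>.\<close>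

lemma norm_scalar_op_compose:
  fixes T :: "'b::real_normed_vector \<Rightarrow>\<^sub>L 'a::complex_hilbert_space"
  shows "norm (scalar_op c o\<^sub>L T) = cmod c * norm T"
proof (rule antisym)
  have *: "norm (scalar_op c o\<^sub>L T) \<le> cmod c * norm T" for c and T :: "'b \<Rightarrow>\<^sub>L 'a"
    by (rule norm_blinfun_bound)
      (simp_all add: scalar_op.rep_eq norm_scaleC mult.assoc mult_left_mono norm_blinfun)
  show "norm (scalar_op c o\<^sub>L T) \<le> cmod c * norm T" by (rule *)
  show "cmod c * norm T \<le> norm (scalar_op c o\<^sub>L T)"
  proof (cases "c = 0")
    case False
    have "scalar_op (inverse c) o\<^sub>L (scalar_op c o\<^sub>L T) = T"
      by (rule blinfun_eqI) (simp add: scalar_op.rep_eq scaleC_scaleC False)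
    hence "norm T \<le> inverse (cmod c) * norm (scalar_op c o\<^sub>L T)"
      using *[of "inverse c" "scalar_op c o\<^sub>L T"] by (simp add: norm_inverse)
    thus ?thesis using False by (simp add: field_simps)
  qed simp
qed

lemma scalar_op_compose_op_ball:
  assumes "X \<in> op_ball" "cmod c \<le> 1"
  shows "(\<lambda>i. scalar_op c o\<^sub>L X i) \<in> op_ball"
proof -
  have "cmod c * norm (row_op X) \<le> norm (row_op X)"
    using assms(2) by (simp add: mult_left_le_one_le)
  thus ?thesis
    using assms unfolding op_ball_iff row_op_scalar_op_compose norm_scalar_op_compose
    by (auto simp: bounded_ops_def scalar_op.rep_eq scaleC_scaleC mult.commute)
qed

lemma scaleR_op_ball: "X \<in> op_ball \<Longrightarrow> \<bar>r\<bar> * norm (row_op X) < 1 \<Longrightarrow> (\<lambda>i. r *\<^sub>R X i) \<in> op_ball"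
  by (auto simp: op_ball_iff row_op_scaleR bounded_ops_def blinfun.scaleR_left scaleC_scaleR)

lemma zero_op_ball [simp]: "(\<lambda>_. 0) \<in> op_ball"
proof -
  have "row_op (\<lambda>_ :: 'a. 0 :: 'b \<Rightarrow>\<^sub>L 'b) = 0"
    by (rule blinfun_eqI) (simp add: row_op.rep_eq)
  thus ?thesis by (auto simp: op_ball_iff bounded_ops_def)
qed

lemma op_ball_nonempty [simp]:
  "(op_ball :: ('n::finite \<Rightarrow> 'a::complex_hilbert_space \<Rightarrow>\<^sub>L 'a) set) \<noteq> {}"
  using zero_op_ball by (metis empty_iff)

section \<open>Scalar tuples as row operators\<close>

text \<open>The adjoint of the scalar row \<open>\<zeta>\<close>, applied to \<open>u\<close>. The
  row attains its norm on these vectors.\<close>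

definition conj_column :: "complex ^ 'm \<Rightarrow> 'a::complex_hilbert_space \<Rightarrow> 'a ^ 'm::finite" where
  "conj_column \<zeta> u = (\<chi> i. cnj (\<zeta> $ i) *\<^sub>C u)"

lemma norm_conj_column: "norm (conj_column \<zeta> u) = norm \<zeta> * norm u"
proof (rule power2_eq_imp_eq)
  show "(norm (conj_column \<zeta> u))\<^sup>2 = (norm \<zeta> * norm u)\<^sup>2"
    by (simp add: norm_vec_power2 power_mult_distrib conj_column_def norm_scaleC sum_distrib_right)
qed simp_all

lemma row_op_scalar_tuple_conj_column:
  "blinfun_apply (row_op (scalar_tuple \<zeta>)) (conj_column \<zeta> u) = (norm \<zeta>)\<^sup>2 *\<^sub>R u"
proof -
  have sq: "\<zeta> $ i * cnj (\<zeta> $ i) = complex_of_real ((norm (\<zeta> $ i))\<^sup>2)" for i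
    by (simp only: complex_norm_square)
  have "blinfun_apply (row_op (scalar_tuple \<zeta>)) (conj_column \<zeta> u) = (\<Sum>i\<in>UNIV. (norm (\<zeta> $ i))\<^sup>2 *\<^sub>R u)"
    unfolding row_op.rep_eq scalar_tuple_def scalar_op.rep_eq conj_column_def vec_lambda_beta scaleC_scaleC sq
    by (simp only: scaleR_scaleC)
  also have "\<dots> = (norm \<zeta>)\<^sup>2 *\<^sub>R u" by (simp add: norm_vec_power2 scaleR_sum_left)
  finally show ?thesis .
qed

text \<open>The upper bound is the Cauchy--Schwarz inequality over the index type; the lower one is
  tested on \<open>conj_column\<close>.\<close>

lemma norm_row_op_scalar_tuple:
  fixes \<zeta> :: "complex ^ 'm::finite"
  assumes "\<exists>x :: 'a::complex_hilbert_space. x \<noteq> 0"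
  shows "norm (row_op (scalar_tuple \<zeta> :: 'm \<Rightarrow> 'a \<Rightarrow>\<^sub>L 'a)) = norm \<zeta>"
proof (rule antisym)
  let ?T = "row_op (scalar_tuple \<zeta> :: 'm \<Rightarrow> 'a \<Rightarrow>\<^sub>L 'a)"
  show "norm ?T \<le> norm \<zeta>"
  proof (rule norm_blinfun_bound)
    fix v :: "'a ^ 'm"
    have "norm (blinfun_apply ?T v) \<le> (\<Sum>i\<in>UNIV. norm (\<zeta> $ i) * norm (v $ i))"
      by (simp add: row_op.rep_eq scalar_tuple_def scalar_op.rep_eq norm_scaleC sum_norm_le)
    also have "\<dots> \<le> norm \<zeta> * norm v"
      unfolding norm_vec_def
      using L2_set_mult_ineq[of "\<lambda>i. norm (\<zeta> $ i)" "\<lambda>i. norm (v $ i)" UNIV] by simp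
    finally show "norm (blinfun_apply ?T v) \<le> norm \<zeta> * norm v" .
  qed simp
  obtain x :: 'a where x: "x \<noteq> 0" using assms by blast
  have "(norm \<zeta>)\<^sup>2 * norm x \<le> norm ?T * (norm \<zeta> * norm x)"
    using norm_blinfun[of ?T "conj_column \<zeta> x"]
    by (simp add: row_op_scalar_tuple_conj_column norm_conj_column)
  hence "norm \<zeta> * (norm \<zeta> * norm x) \<le> norm ?T * (norm \<zeta> * norm x)"
    by (simp add: power2_eq_square mult.assoc)
  thus "norm \<zeta> \<le> norm ?T"
    using x by (cases "norm \<zeta> = 0") auto
qed

lemma scalar_tuple_inject:
  assumes "\<exists>x :: 'a::complex_hilbert_space. x \<noteq> 0"
    and "(scalar_tuple \<zeta> :: 'm::finite \<Rightarrow> 'a \<Rightarrow>\<^sub>L 'a) = scalar_tuple \<xi>"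
  shows "\<zeta> = \<xi>"
proof -
  obtain x :: 'a where x: "x \<noteq> 0" using assms by blast
  have "\<zeta> $ i = \<xi> $ i" for i
  proof -
    have "\<zeta> $ i *\<^sub>C x = \<xi> $ i *\<^sub>C x"
      using fun_cong[OF assms(2), of i] by (metis scalar_tuple_def scalar_op.rep_eq)
    hence "(\<zeta> $ i - \<xi> $ i) *\<^sub>C x = 0"
      by (metis add_right_cancel add_0 diff_add_cancel scaleC_add_left)
    thus ?thesis using x by (metis eq_iff_diff_eq_0 mult_eq_0_iff norm_eq_zero norm_scaleC)
  qed
  thus ?thesis by (simp add: vec_eq_iff)
qed

section \<open>Schwarz--Pick estimates along complex lines\<close>

text \<open>Schwarz--Pick: a Moebius map moves \<open>f 0\<close> to the origin, the Schwarz lemma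
  bounds the result \<open>g z\<close> by \<open>s\<close>, and the inverse Moebius map turns this
  into a bound on \<open>f z\<close>.\<close>

lemma scalar_pick_bound:
  assumes hol: "f holomorphic_on ball 0 1" and bnd: "\<And>w. cmod w < 1 \<Longrightarrow> cmod (f w) \<le> 1"
    and q: "cmod (f 0) \<le> q" "q < 1" and z: "cmod z \<le> s" "s < 1"
  shows "cmod (f z) \<le> sqrt (1 - (1 - q\<^sup>2) * (1 - s\<^sup>2) / 4)"
proof -
  \<comment> \<open>The Moebius map needs values in the open disc. A value of modulus 1 would make
    \<open>f\<close> constant, against the bound \<open>q < 1\<close> at the origin.\<close>
  have strict: "cmod (f w) < 1" if w: "cmod w < 1" for w
  proof (rule ccontr)
    assume "\<not> cmod (f w) < 1"
    hence fw: "cmod (f w) = 1" using bnd[OF w] by simp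
    have "f constant_on ball 0 1"
      by (rule maximum_modulus_principle[OF hol, of "ball 0 1" w]) (use w bnd fw in auto)
    hence "f 0 = f w" using w by (auto simp: constant_on_def)
    thus False using fw q by simp
  qed
  define c where "c = f 0"
  define g where "g w = Moebius_function 0 c (f w)" for w
  have c: "cmod c < 1" using q by (simp add: c_def)
  have holg: "g holomorphic_on ball 0 1"
    unfolding g_def
    by (rule holomorphic_on_compose_gen[OF hol Moebius_function_holomorphic[OF c], unfolded o_def])
      (use strict in auto)
  have g0: "g 0 = 0" by (simp add: g_def c_def Moebius_function_eq_zero)
  have g1: "cmod (g w) < 1" if "cmod w < 1" for w
    unfolding g_def by (rule Moebius_function_norm_lt_1[OF c strict[OF that]])
  have gz: "cmod (g z) \<le> s"
    using Schwarz_Lemma(1)[OF holg g0 g1, of z] z by simp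
  have "f z = Moebius_function 0 (- c) (g z)"
    unfolding g_def by (rule Moebius_function_compose[symmetric]) (use c strict z in auto)
  hence fz: "f z = (g z + c) / (1 + cnj c * g z)" by (simp add: Moebius_function_simple)
  define w where "w = g z"
  have w: "cmod w \<le> s" "cmod w < 1" using gz z by (auto simp: w_def)
  have "cmod (cnj c * w) < 1" using norm_mult_less[of "cnj c" 1 w 1] c w(2) by simp
  hence nz: "1 + cnj c * w \<noteq> 0"
    by (auto simp: add_eq_0_iff)
  \<comment> \<open>The classical identity for disc automorphisms, checked in real and imaginary
    parts.\<close>
  have "(cmod (1 + cnj c * w))\<^sup>2 - (cmod (w + c))\<^sup>2 = (1 - (cmod c)\<^sup>2) * (1 - (cmod w)\<^sup>2)"
    unfolding cmod_power2 by (simp add: power2_eq_square algebra_simps)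
  hence id: "1 - (cmod (f z))\<^sup>2 = (1 - (cmod c)\<^sup>2) * (1 - (cmod w)\<^sup>2) / (cmod (1 + cnj c * w))\<^sup>2"
    using nz by (simp add: fz w_def[symmetric] norm_divide power_divide field_simps)
  have "cmod (1 + cnj c * w) \<le> 2"
    using norm_triangle_ineq[of 1 "cnj c * w"] \<open>cmod (cnj c * w) < 1\<close> by simp
  \<comment> \<open>The crude bound 2 for the modulus of the denominator is the source of the 4 in
    the final estimate.\<close>
  hence le4: "(cmod (1 + cnj c * w))\<^sup>2 \<le> 4"
    using power_mono[of "cmod (1 + cnj c * w)" 2 2] by simp
  have qs: "(cmod c)\<^sup>2 \<le> q\<^sup>2" "(cmod w)\<^sup>2 \<le> s\<^sup>2" "q\<^sup>2 \<le> 1" "s\<^sup>2 \<le> 1"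
    using q z w order_trans[OF norm_ge_zero, of "f 0" q] order_trans[OF norm_ge_zero, of z s]
    by (auto simp: c_def abs_square_le_1 intro!: power_mono)
  have "(1 - q\<^sup>2) * (1 - s\<^sup>2) / 4 \<le> (1 - (cmod c)\<^sup>2) * (1 - (cmod w)\<^sup>2) / (cmod (1 + cnj c * w))\<^sup>2"
    by (intro frac_le mult_mono le4) (use qs nz in auto)
  hence "(cmod (f z))\<^sup>2 \<le> 1 - (1 - q\<^sup>2) * (1 - s\<^sup>2) / 4" using id by linarith
  thus ?thesis by (rule real_le_rsqrt)
qed

text \<open>The contraction constant of the operator estimate. It is not sharp; what matters is that
  it lies below 1 and does not depend on the function or on the test vectors.\<close>

definition pick_bound :: "real \<Rightarrow> real \<Rightarrow> real" where
  "pick_bound q s = sqrt (1 - (1 - q\<^sup>2) * (1 - s\<^sup>2) / 4)"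

lemma pick_bound_less_one:
  assumes "0 \<le> q" "q < 1" "0 \<le> s" "s < 1"
  shows "pick_bound q s < 1"
proof -
  have "q\<^sup>2 < 1" "s\<^sup>2 < 1" using assms by (auto simp: abs_square_less_1)
  thus ?thesis by (simp add: pick_bound_def)
qed

lemma pick_bound_nonneg:
  assumes "0 \<le> q" "q < 1" "0 \<le> s" "s < 1"
  shows "0 \<le> pick_bound q s"
proof -
  have "(1 - q\<^sup>2) * (1 - s\<^sup>2) \<le> 1 * 1"
    using assms by (intro mult_mono) (auto simp: abs_square_le_1)
  thus ?thesis by (simp add: pick_bound_def)
qed

text \<open>Normalisation by the bound \<open>C\<close>. The case \<open>C = 0\<close> is separate
  because \<open>C\<close> will contain norms of test vectors, which may vanish.\<close>

lemma scaled_pick_bound: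
  assumes hol: "f holomorphic_on ball 0 1" and bnd: "\<And>w. cmod w < 1 \<Longrightarrow> cmod (f w) \<le> C"
    and q: "cmod (f 0) \<le> q * C" "q < 1" and z: "cmod z \<le> s" "s < 1"
  shows "cmod (f z) \<le> pick_bound q s * C"
proof (cases "C = 0")
  case True
  thus ?thesis using bnd[of z] z by simp
next
  case False
  moreover have "0 \<le> C" using order_trans[OF norm_ge_zero bnd[of 0]] by simp
  ultimately have C: "0 < C" by simp
  have "cmod (f z / C) \<le> pick_bound q s"
    unfolding pick_bound_def
    by (rule scalar_pick_bound[of "\<lambda>w. f w / C"])
      (use C bnd q z hol in \<open>auto intro!: holomorphic_intros simp: norm_divide field_simps\<close>)
  thus ?thesis using C by (simp add: norm_divide field_simps)
qed

section \<open>Expansions restricted to complex lines\<close>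

text \<open>Bounded real-linear maps carry a real scalar multiplication, so a complex factor is
  written as composition with \<open>scalar_op z\<close>.\<close>

abbreviation cscale :: "complex \<Rightarrow> ('n \<Rightarrow> 'a \<Rightarrow>\<^sub>L 'a::complex_hilbert_space) \<Rightarrow> 'n \<Rightarrow> 'a \<Rightarrow>\<^sub>L 'a" where
  "cscale z X \<equiv> \<lambda>i. scalar_op z o\<^sub>L X i"

lemma scalar_op_of_real_compose: "scalar_op (complex_of_real r) o\<^sub>L T = r *\<^sub>R T"
  by (rule blinfun_eqI) (simp add: scalar_op.rep_eq blinfun.scaleR_left scaleR_scaleC)

lemma cscale_of_real: "cscale (complex_of_real r) X = (\<lambda>i. r *\<^sub>R X i)"
  by (simp add: scalar_op_of_real_compose)

lemma cscale_cscale: "cscale z (cscale w X) = cscale (z * w) X"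
  by (rule ext, rule blinfun_eqI) (simp add: scalar_op.rep_eq scaleC_scaleC)

lemma cscale_zero [simp]: "cscale 0 X = (\<lambda>_. 0)"
  by (rule ext, rule blinfun_eqI) (simp add: scalar_op.rep_eq)

text \<open>Complex linearity of the \<open>X i\<close> lets every factor \<open>z\<close> move to
  the left.\<close>

lemma monomial_cscale:
  assumes "\<And>i. X i \<in> bounded_ops"
  shows "monomial (cscale z X) \<alpha> = scalar_op (z ^ length \<alpha>) o\<^sub>L monomial X \<alpha>"
proof (induction \<alpha>)
  case Nil
  show ?case by (rule blinfun_eqI) (simp add: monomial_def scalar_op.rep_eq)
next
  case (Cons i \<alpha>)
  have "monomial (cscale z X) (i # \<alpha>) = (scalar_op z o\<^sub>L X i) o\<^sub>L monomial (cscale z X) \<alpha>"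
    by (simp add: monomial_def)
  also have "\<dots> = scalar_op (z ^ length (i # \<alpha>)) o\<^sub>L (X i o\<^sub>L monomial X \<alpha>)"
    unfolding Cons using assms[of i]
    by (intro blinfun_eqI) (simp add: scalar_op.rep_eq bounded_ops_def scaleC_scaleC)
  finally show ?case by (simp add: monomial_def)
qed

lemma homogeneous_part_apply:
  "blinfun_apply (homogeneous_part a X k) x = (\<Sum>\<alpha> | length \<alpha> = k. a \<alpha> *\<^sub>C blinfun_apply (monomial X \<alpha>) x)"
  by (simp add: homogeneous_part_def blinfun.sum_left scalar_op.rep_eq)

lemma homogeneous_part_cscale:
  assumes "\<And>i. X i \<in> bounded_ops"
  shows "homogeneous_part a (cscale z X) k = scalar_op (z ^ k) o\<^sub>L homogeneous_part a X k"
  by (rule blinfun_eqI)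
    (simp add: homogeneous_part_apply monomial_cscale[OF assms] scalar_op.rep_eq scaleC_sum
      scaleC_scaleC mult.commute)

lemma homogeneous_part_0: "homogeneous_part a X 0 = scalar_op (a [])"
  by (rule blinfun_eqI) (simp add: homogeneous_part_apply monomial_def scalar_op.rep_eq)

text \<open>Collects the convergent expansions of all components. The notion passes to dilations, so
  the estimates below also apply to the maps of part (iii).\<close>

definition expands ::
    "('m \<Rightarrow> 'n::finite list \<Rightarrow> complex) \<Rightarrow> (('n \<Rightarrow> 'a \<Rightarrow>\<^sub>L 'a) \<Rightarrow> 'm::finite \<Rightarrow> 'a::complex_hilbert_space \<Rightarrow>\<^sub>L 'a) \<Rightarrow> bool" where
  "expands a \<phi> \<longleftrightarrow> (\<forall>X\<in>op_ball. \<forall>i. homogeneous_part (a i) X sums \<phi> X i)"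

lemma cinner_sum_left:
  "cinner (\<Sum>i\<in>A. f i) (y :: 'a::complex_hilbert_space) = (\<Sum>i\<in>A. cinner (f i) y)"
  by (induction A rule: infinite_finite_induct) (auto simp: cinner_add_left)

text \<open>The homogeneous part of degree \<open>k\<close> scales by \<open>z ^ k\<close>: along a
  line the map is an operator-valued power series in \<open>z\<close>.\<close>

lemma expands_cscale:
  assumes "expands a \<phi>" "X \<in> op_ball" "cmod z \<le> 1"
  shows "(\<lambda>k. scalar_op (z ^ k) o\<^sub>L homogeneous_part (a i) X k) sums \<phi> (cscale z X) i"
proof -
  have "homogeneous_part (a i) (cscale z X) = (\<lambda>k. scalar_op (z ^ k) o\<^sub>L homogeneous_part (a i) X k)"
    using assms(2) by (intro ext homogeneous_part_cscale) (simp add: op_ball_iff)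
  thus ?thesis
    using assms scalar_op_compose_op_ball[OF assms(2,3)] by (metis expands_def)
qed

lemma expands_zero:
  fixes \<phi> :: "('n::finite \<Rightarrow> 'a \<Rightarrow>\<^sub>L 'a) \<Rightarrow> 'm::finite \<Rightarrow> 'a::complex_hilbert_space \<Rightarrow>\<^sub>L 'a"
  assumes "expands a \<phi>"
  shows "\<phi> (\<lambda>_. 0) = scalar_tuple (\<chi> i. a i [])"
proof
  fix i
  \<comment> \<open>The zero tuple is viewed as its own multiple by 0; as \<open>0 ^ 0 = 1\<close>,
    the term of degree 0 alone survives.\<close>
  have "(\<lambda>k. scalar_op (0 ^ k) o\<^sub>L homogeneous_part (a i) (\<lambda>_. 0) k) sums \<phi> (\<lambda>_. 0) i"
    using expands_cscale[OF assms zero_op_ball, of 0] by simp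
  moreover have "(\<lambda>k. scalar_op (0 ^ k) o\<^sub>L homogeneous_part (a i) (\<lambda>_. 0 :: 'a \<Rightarrow>\<^sub>L 'a) k)
      = (\<lambda>k. if k = 0 then scalar_op (a i []) else 0)"
    by (intro ext blinfun_eqI) (simp add: homogeneous_part_0 scalar_op.rep_eq power_0_left)
  ultimately have "(\<lambda>k. if k = 0 then scalar_op (a i []) else 0) sums \<phi> (\<lambda>_. 0) i"
    by simp
  from sums_unique2[OF this sums_single[of 0 "\<lambda>_. scalar_op (a i [])"]]
  show "\<phi> (\<lambda>_. 0) i = scalar_tuple (\<chi> i. a i []) i"
    by (simp add: scalar_tuple_def)
qed

text \<open>Pairing with fixed vectors turns the operator series into a scalar power series
  converging on the whole disc.\<close>

lemma expands_line_holomorphic: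
  assumes "expands a \<phi>" "X \<in> op_ball"
  shows "(\<lambda>z. cinner (blinfun_apply (row_op (\<phi> (cscale z X))) v) y) holomorphic_on ball 0 1"
proof (rule power_series_holomorphic)
  fix z :: complex assume "z \<in> ball 0 1"
  hence z: "cmod z \<le> 1" by simp
  have "(\<lambda>k. cinner (blinfun_apply (scalar_op (z ^ k) o\<^sub>L homogeneous_part (a i) X k) (v $ i)) y)
      sums cinner (blinfun_apply (\<phi> (cscale z X) i) (v $ i)) y" for i
    by (rule bounded_linear.sums[OF bounded_linear_cinner_left],
        rule bounded_linear.sums[OF blinfun.bounded_linear_left], rule expands_cscale[OF assms z])
  hence "(\<lambda>k. \<Sum>i\<in>UNIV. cinner (blinfun_apply (scalar_op (z ^ k) o\<^sub>L homogeneous_part (a i) X k) (v $ i)) y)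
      sums (\<Sum>i\<in>UNIV. cinner (blinfun_apply (\<phi> (cscale z X) i) (v $ i)) y)"
    by (intro sums_sum)
  thus "(\<lambda>k. (\<Sum>i\<in>UNIV. cinner (blinfun_apply (homogeneous_part (a i) X k) (v $ i)) y) * (z - 0) ^ k)
      sums cinner (blinfun_apply (row_op (\<phi> (cscale z X))) v) y"
    by (simp add: row_op.rep_eq scalar_op.rep_eq cinner_scaleC_left sum_distrib_left mult.commute
        cinner_sum_left)
qed

text \<open>The operator form of the Schwarz--Pick estimate, obtained by testing with vectors. The
  constant is the same for all test vectors, so it bounds the operator norm.\<close>

lemma expands_pick:
  fixes \<phi> :: "('n::finite \<Rightarrow> 'a \<Rightarrow>\<^sub>L 'a) \<Rightarrow> 'm::finite \<Rightarrow> 'a::complex_hilbert_space \<Rightarrow>\<^sub>L 'a"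
  assumes exp: "expands a \<phi>" and bnd: "\<And>X. X \<in> op_ball \<Longrightarrow> norm (row_op (\<phi> X)) \<le> M"
    and q: "norm (row_op (\<phi> (\<lambda>_. 0))) \<le> q * M" "0 \<le> q" "q < 1"
    and X: "X \<in> op_ball" and z: "cmod z \<le> s" "s < 1"
  shows "norm (row_op (\<phi> (cscale z X))) \<le> pick_bound q s * M"
proof (rule norm_blinfun_bound)
  have s: "0 \<le> s" using z norm_ge_zero[of z] by linarith
  have M: "0 \<le> M" using bnd[OF X] norm_ge_zero[of "row_op (\<phi> X)"] by linarith
  show "0 \<le> pick_bound q s * M"
    using pick_bound_nonneg[of q s] q z s M by simp
  fix v :: "'a ^ 'm"
  \<comment> \<open>With this choice the scalar function takes the value \<open>cinner y y\<close>
    at \<open>z\<close>, so its bound is a bound on the norm of \<open>y\<close> after cancelling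
    one factor.\<close>
  define y where "y = blinfun_apply (row_op (\<phi> (cscale z X))) v"
  have C: "cmod (cinner (blinfun_apply T v) y) \<le> norm T * (norm v * norm y)" for T :: "('a ^ 'm) \<Rightarrow>\<^sub>L 'a"
  proof -
    have "cmod (cinner (blinfun_apply T v) y) \<le> norm (blinfun_apply T v) * norm y"
      by (rule cinner_cauchy_schwarz)
    also have "\<dots> \<le> norm T * norm v * norm y" by (intro mult_right_mono norm_blinfun) simp
    finally show ?thesis by (simp add: mult.assoc)
  qed
  have "cmod (cinner (blinfun_apply (row_op (\<phi> (cscale z X))) v) y)
      \<le> pick_bound q s * (M * (norm v * norm y))"
  proof (rule scaled_pick_bound[OF expands_line_holomorphic[OF exp X] _ _ q(3) z])
    fix w :: complex assume "cmod w < 1"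
    hence "norm (row_op (\<phi> (cscale w X))) \<le> M"
      by (intro bnd scalar_op_compose_op_ball X) simp
    thus "cmod (cinner (blinfun_apply (row_op (\<phi> (cscale w X))) v) y) \<le> M * (norm v * norm y)"
      using C[of "row_op (\<phi> (cscale w X))"] by (meson mult_right_mono mult_nonneg_nonneg norm_ge_zero order_trans)
  next
    show "cmod (cinner (blinfun_apply (row_op (\<phi> (cscale 0 X))) v) y) \<le> q * (M * (norm v * norm y))"
      using C[of "row_op (\<phi> (\<lambda>_. 0))"] mult_right_mono[OF q(1), of "norm v * norm y"]
      by (simp add: mult.assoc)
  qed
  hence "norm y * norm y \<le> norm y * (pick_bound q s * M * norm v)"
    by (simp add: y_def[symmetric] cinner_self norm_mult power2_eq_square mult_ac)
  thus "norm y \<le> pick_bound q s * M * norm v"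
    using \<open>0 \<le> pick_bound q s * M\<close> by (cases "y = 0") auto
qed

text \<open>Places \<open>X\<close> strictly inside the disc of a complex line through the origin,
  where the scalar function is holomorphic.\<close>

lemma op_ball_dilate:
  assumes "X \<in> op_ball"
  obtains t Y where "0 < t" "t < 1" "Y \<in> op_ball" "X = cscale (complex_of_real t) Y"
proof -
  \<comment> \<open>The entry \<open>1/2\<close> keeps \<open>t\<close> positive when
    \<open>X\<close> is zero.\<close>
  obtain t where t: "max (norm (row_op X)) (1/2) < t" "t < 1"
    using dense[of "max (norm (row_op X)) (1/2)" 1] assms by (auto simp: op_ball_iff)
  define Y where "Y = (\<lambda>i. (1 / t) *\<^sub>R X i)"
  have "Y \<in> op_ball" unfolding Y_def using assms t
    by (intro scaleR_op_ball) (auto simp: field_simps)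
  moreover have "X = cscale (complex_of_real t) Y"
    unfolding cscale_of_real Y_def using t by auto
  ultimately show thesis using that[of t Y] t by simp
qed

text \<open>The pairing of \<open>\<phi> X\<close> on \<open>conj_column \<zeta> u\<close> with
  \<open>u\<close> is maximal at the origin, hence constant on each line. The equality case of
  Cauchy--Schwarz then determines the adjoint of the row on every \<open>u\<close>, and with it the
  row itself.\<close>

lemma expands_max_imp_constant:
  fixes \<phi> :: "('n::finite \<Rightarrow> 'a \<Rightarrow>\<^sub>L 'a) \<Rightarrow> 'm::finite \<Rightarrow> 'a::complex_hilbert_space \<Rightarrow>\<^sub>L 'a"
  assumes exp: "expands a \<phi>" and bnd: "\<And>X. X \<in> op_ball \<Longrightarrow> norm (row_op (\<phi> X)) \<le> norm \<zeta>"
    and \<phi>0: "\<phi> (\<lambda>_. 0) = scalar_tuple \<zeta>" and X: "X \<in> op_ball"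
  shows "\<phi> X = scalar_tuple \<zeta>"
proof -
  define T where "T = row_op (\<phi> X)"
  define S where "S = real_adjoint T"
  have Tmax: "inner (blinfun_apply T (conj_column \<zeta> u)) u = (norm \<zeta> * norm u)\<^sup>2" for u
  proof -
    obtain t Y where tY: "0 < t" "t < 1" "Y \<in> op_ball" "X = cscale (complex_of_real t) Y"
      using op_ball_dilate[OF X] by blast
    define f where "f z = cinner (blinfun_apply (row_op (\<phi> (cscale z Y))) (conj_column \<zeta> u)) u" for z
    have hol: "f holomorphic_on ball 0 1"
      unfolding f_def by (rule expands_line_holomorphic[OF exp tY(3)])
    \<comment> \<open>This value at the origin equals the bound that holds on the whole disc, so the
      maximum modulus principle applies.\<close>
    have f0: "f 0 = complex_of_real ((norm \<zeta> * norm u)\<^sup>2)"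
      by (simp add: f_def \<phi>0 row_op_scalar_tuple_conj_column scaleR_scaleC cinner_scaleC_left cinner_self
          power_mult_distrib)
    have "cmod (f z) \<le> (norm \<zeta> * norm u)\<^sup>2" if "cmod z < 1" for z
    proof -
      have "cmod (f z) \<le> norm (blinfun_apply (row_op (\<phi> (cscale z Y))) (conj_column \<zeta> u)) * norm u"
        unfolding f_def by (rule cinner_cauchy_schwarz)
      also have "\<dots> \<le> norm (row_op (\<phi> (cscale z Y))) * norm (conj_column \<zeta> u) * norm u"
        by (intro mult_right_mono norm_blinfun) simp
      also have "\<dots> \<le> norm \<zeta> * norm (conj_column \<zeta> u) * norm u"
        using that by (intro mult_right_mono bnd scalar_op_compose_op_ball tY) auto
      finally show ?thesis by (simp add: norm_conj_column power2_eq_square mult_ac)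
    qed
    hence "\<And>z. z \<in> ball 0 1 \<Longrightarrow> cmod (f z) \<le> cmod (f 0)"
      by (simp add: f0 norm_mult power_mult_distrib norm_power)
    hence "f constant_on ball 0 1"
      by (intro maximum_modulus_principle[OF hol, of "ball 0 1" 0]) auto
    hence "f (complex_of_real t) = f 0" using tY by (auto simp: constant_on_def)
    hence "cinner (blinfun_apply T (conj_column \<zeta> u)) u = complex_of_real ((norm \<zeta> * norm u)\<^sup>2)"
      unfolding f0 by (simp only: f_def T_def tY(4))
    thus ?thesis by (simp only: inner_cinner Re_complex_of_real)
  qed
  \<comment> \<open>the equality case of the Cauchy--Schwarz inequality\<close>
  have S: "blinfun_apply S u = conj_column \<zeta> u" for u
  proof -
    have "inner u (blinfun_apply T (conj_column \<zeta> u)) = inner (blinfun_apply S u) (conj_column \<zeta> u)"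
      unfolding S_def by (metis inner_commute inner_real_adjoint)
    hence ip: "inner (blinfun_apply S u) (conj_column \<zeta> u) = (norm \<zeta> * norm u)\<^sup>2"
      using Tmax by (simp add: inner_commute)
    have nT: "norm T \<le> norm \<zeta>" unfolding T_def by (rule bnd[OF X])
    have "norm (blinfun_apply S u) \<le> norm T * norm u"
      unfolding S_def by (rule norm_adjoint_le) (rule inner_real_adjoint)
    also have "\<dots> \<le> norm \<zeta> * norm u" by (intro mult_right_mono nT) simp
    finally have "norm (blinfun_apply S u) \<le> norm \<zeta> * norm u" .
    hence "(norm (blinfun_apply S u))\<^sup>2 \<le> (norm \<zeta> * norm u)\<^sup>2" by (intro power_mono) auto
    moreover have "(norm (blinfun_apply S u - conj_column \<zeta> u))\<^sup>2
        = (norm (blinfun_apply S u))\<^sup>2 - 2 * inner (blinfun_apply S u) (conj_column \<zeta> u) + (norm (conj_column \<zeta> u))\<^sup>2"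
      by (simp add: power2_norm_eq_inner inner_diff inner_commute)
    ultimately have "(norm (blinfun_apply S u - conj_column \<zeta> u))\<^sup>2 \<le> 0"
      using ip norm_conj_column[of \<zeta> u] by simp
    thus ?thesis by simp
  qed
  \<comment> \<open>Passing back from the adjoint to the components, by testing the row on vectors
    supported in one coordinate.\<close>
  show ?thesis
  proof (rule ext, rule blinfun_eqI)
    fix i w
    have "inner (blinfun_apply (\<phi> X i) w) u = inner (\<zeta> $ i *\<^sub>C w) u" for u
    proof -
      have "inner (blinfun_apply (\<phi> X i) w) u = inner (axis i w) (conj_column \<zeta> u)"
        by (simp add: S_def inner_real_adjoint T_def flip: S row_op_axis)
      also have "\<dots> = inner w (cnj (\<zeta> $ i) *\<^sub>C u)"
        unfolding inner_vec_def conj_column_def vec_lambda_beta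
        by (rule sum_axis[of "\<lambda>j t. inner t (cnj (\<zeta> $ j) *\<^sub>C u)"]) simp
      finally show ?thesis by (simp add: inner_scaleC)
    qed
    thus "blinfun_apply (\<phi> X i) w = blinfun_apply (scalar_tuple \<zeta> i) w"
      unfolding scalar_tuple_def scalar_op.rep_eq by (metis vector_eq_rdot)
  qed
qed

text \<open>The identity theorem on lines: constancy on the ball of radius \<open>\<rho>\<close>
  gives constancy of the scalar functions on a smaller disc, hence on the unit disc.\<close>

lemma expands_identity:
  fixes \<phi> :: "('n::finite \<Rightarrow> 'a \<Rightarrow>\<^sub>L 'a) \<Rightarrow> 'm::finite \<Rightarrow> 'a::complex_hilbert_space \<Rightarrow>\<^sub>L 'a"
  assumes exp: "expands a \<phi>" and \<rho>: "0 < \<rho>" "\<rho> \<le> 1"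
    and eq: "\<And>X. X \<in> op_ball \<Longrightarrow> \<phi> (\<lambda>i. \<rho> *\<^sub>R X i) = C" and X: "X \<in> op_ball"
  shows "\<phi> X = C"
proof -
  obtain t Y where tY: "0 < t" "t < 1" "Y \<in> op_ball" "X = cscale (complex_of_real t) Y"
    using op_ball_dilate[OF X] by blast
  have "cinner (blinfun_apply (row_op (\<phi> X)) v) y = cinner (blinfun_apply (row_op C) v) y" for v y
  proof -
    have "cinner (blinfun_apply (row_op (\<phi> (cscale (complex_of_real t) Y))) v) y
        = cinner (blinfun_apply (row_op C) v) y"
    proof (rule analytic_continuation_open[where s = "ball 0 \<rho>" and s' = "ball 0 1"
          and f = "\<lambda>z. cinner (blinfun_apply (row_op (\<phi> (cscale z Y))) v) y"
          and g = "\<lambda>_. cinner (blinfun_apply (row_op C) v) y"])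
      show "(\<lambda>z. cinner (blinfun_apply (row_op (\<phi> (cscale z Y))) v) y) holomorphic_on ball 0 1"
        by (rule expands_line_holomorphic[OF exp tY(3)])
      fix z :: complex assume z: "z \<in> ball 0 \<rho>"
      \<comment> \<open>The factor \<open>\<rho>\<close> is split off so that the remaining scalar
        \<open>z / \<rho>\<close> still has modulus below 1.\<close>
      have "cscale z Y = (\<lambda>i. \<rho> *\<^sub>R cscale (z / \<rho>) Y i)"
        unfolding cscale_of_real[symmetric] cscale_cscale using \<rho> by simp
      moreover have "cscale (z / \<rho>) Y \<in> op_ball"
        using z \<rho> by (intro scalar_op_compose_op_ball tY) (simp add: norm_divide)
      ultimately show "cinner (blinfun_apply (row_op (\<phi> (cscale z Y))) v) y = cinner (blinfun_apply (row_op C) v) y"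
        using eq by simp
    qed (use \<rho> tY in auto)
    thus ?thesis by (simp flip: tY(4))
  qed
  hence "inner (blinfun_apply (row_op (\<phi> X)) v) y = inner (blinfun_apply (row_op C) v) y" for v y
    by (simp add: inner_cinner)
  hence eq: "blinfun_apply (row_op (\<phi> X)) v = blinfun_apply (row_op C) v" for v
    by (metis vector_eq_rdot)
  show ?thesis
  proof (intro ext blinfun_eqI)
    fix i w show "blinfun_apply (\<phi> X i) w = blinfun_apply (C i) w"
      using eq[of "axis i w"] by (simp add: row_op_axis)
  qed
qed

section \<open>Orthonormal families and the Fock space\<close>

text \<open>Zorn's lemma yields a maximal orthonormal set. Were it finite, a vector outside its span
  would give one more orthonormal vector by a Gram--Schmidt step.\<close>

lemma orthonormal_sequence_exists:
  assumes "infinite_dimensional TYPE('a::complex_hilbert_space)"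
  shows "\<exists>e :: nat \<Rightarrow> 'a. \<forall>i j. cinner (e i) (e j) = (if i = j then 1 else 0)"
proof -
  interpret vector_space "scaleC :: complex \<Rightarrow> 'a \<Rightarrow> 'a" by (rule vector_space_scaleC)
  define \<A> where "\<A> = {B :: 'a set. \<forall>x\<in>B. \<forall>y\<in>B. cinner x y = (if x = y then 1 else 0)}"
  have "\<Union>\<C> \<in> \<A>" if chain: "subset.chain \<A> \<C>" for \<C>
  proof -
    have "cinner x y = (if x = y then 1 else 0)" if xy: "x \<in> \<Union>\<C>" "y \<in> \<Union>\<C>" for x y
    proof -
      obtain C D where "C \<in> \<C>" "D \<in> \<C>" "x \<in> C" "y \<in> D" using xy by blast
      moreover from this have "C \<subseteq> D \<or> D \<subseteq> C" "C \<in> \<A>" "D \<in> \<A>"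
        using chain unfolding subset_chain_def by blast+
      ultimately show ?thesis unfolding \<A>_def by blast
    qed
    thus ?thesis by (simp add: \<A>_def)
  qed
  then obtain B where B: "B \<in> \<A>" and maxB: "\<And>C. C \<in> \<A> \<Longrightarrow> B \<subseteq> C \<Longrightarrow> C = B"
    using subset_Zorn'[of \<A>] by blast
  have "infinite B"
  proof
    assume fin: "finite B"
    then obtain x0 where x0: "x0 \<notin> span B"
      using assms unfolding infinite_dimensional_def by blast
    \<comment> \<open>The orthogonal projection of \<open>x0\<close> onto the span of
      \<open>B\<close>.\<close>
    define p where "p = (\<Sum>b\<in>B. cinner x0 b *\<^sub>C b)"
    have p: "p \<in> span B"
      unfolding p_def by (intro span_sum span_scale span_base)
    define x1 where "x1 = x0 - p"
    have x1: "x1 \<noteq> 0" using x0 p by (auto simp: x1_def)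
    have orth: "cinner x1 b = 0" if b: "b \<in> B" for b
    proof -
      have "cinner p b = (\<Sum>b'\<in>B. cinner x0 b' * (if b' = b then 1 else 0))"
        unfolding p_def cinner_sum_left cinner_scaleC_left
        using B b by (intro sum.cong) (auto simp: \<A>_def)
      also have "\<dots> = cinner x0 b" using fin b by (simp add: if_distrib[of "(*) _"] cong: if_cong)
      finally show ?thesis using cinner_add_left[of x1 p b] by (simp add: x1_def)
    qed
    define x2 where "x2 = (1 / norm x1) *\<^sub>R x1"
    have x2: "cinner x2 x2 = 1" using x1 by (simp add: cinner_self x2_def)
    have orth2: "cinner x2 b = 0" "cinner b x2 = 0" if "b \<in> B" for b
      using orth[OF that] cinner_commute[of b x2] by (auto simp: x2_def scaleR_scaleC cinner_scaleC_left)
    have "insert x2 B \<in> \<A>"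
      using B orth2 x2 unfolding \<A>_def by fastforce
    hence "x2 \<in> B" using maxB by blast
    thus False using orth2(1)[of x2] x2 by simp
  qed
  then obtain e :: "nat \<Rightarrow> 'a" where e: "inj e" "range e \<subseteq> B"
    using infinite_countable_subset by blast
  thus ?thesis
    using B by (intro exI[of _ e]) (auto simp: \<A>_def inj_eq image_subset_iff)
qed

section \<open>An isometric copy of the Fock space inside the given Hilbert space\<close>

definition orthonormal_family :: "('i \<Rightarrow> 'a::complex_hilbert_space) \<Rightarrow> bool" where
  "orthonormal_family e \<longleftrightarrow> (\<forall>i j. cinner (e i) (e j) = (if i = j then 1 else 0))"

text \<open>Meant for words over a finite alphabet, which form a countable type.\<close>

lemma orthonormal_family_exists:
  assumes "infinite_dimensional TYPE('a::complex_hilbert_space)"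
  shows "\<exists>e :: 'i::countable \<Rightarrow> 'a. orthonormal_family e"
proof -
  obtain e :: "nat \<Rightarrow> 'a" where e: "\<And>i j. cinner (e i) (e j) = (if i = j then 1 else 0)"
    using orthonormal_sequence_exists[OF assms] by blast
  hence "orthonormal_family (\<lambda>i :: 'i. e (to_nat i))"
    by (simp add: orthonormal_family_def)
  thus ?thesis by blast
qed

text \<open>For the projection \<open>p\<close> of \<open>y\<close> the products of \<open>p\<close>
  with \<open>p\<close> and with \<open>y\<close> agree, and \<open>y - p\<close> has nonnegative
  square norm.\<close>

lemma bessel_inequality:
  assumes "orthonormal_family e" "finite F"
  shows "(\<Sum>i\<in>F. (cmod (cinner y (e i)))\<^sup>2) \<le> (norm y)\<^sup>2"
proof -
  define p where "p = (\<Sum>i\<in>F. cinner y (e i) *\<^sub>C e i)"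
  have pe: "cinner p (e i) = cinner y (e i)" if "i \<in> F" for i
    using assms that unfolding p_def cinner_sum_left cinner_scaleC_left orthonormal_family_def
    by (simp add: if_distrib[of "(*) _"] cong: if_cong)
  have py: "cinner p x = (\<Sum>i\<in>F. cinner y (e i) * cnj (cinner x (e i)))" for x
    unfolding p_def cinner_sum_left cinner_scaleC_left
    by (intro sum.cong) (auto simp: cinner_commute[of x])
  have "cinner p p = (\<Sum>i\<in>F. cinner y (e i) * cnj (cinner y (e i)))"
    unfolding py[of p] using pe by (intro sum.cong) auto
  also have "\<dots> = cinner p y" by (simp only: py)
  finally have "cinner p p = cinner p y" .
  hence "inner p p = inner p y" by (simp add: inner_cinner)
  moreover have "0 \<le> inner (y - p) (y - p)" by simp
  ultimately have "inner p y \<le> inner y y" by (simp add: inner_diff inner_commute)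
  moreover have "inner p y = (\<Sum>i\<in>F. (cmod (cinner y (e i)))\<^sup>2)"
    unfolding inner_cinner py Re_sum by (simp flip: complex_norm_square)
  ultimately show ?thesis by (simp add: power2_norm_eq_inner)
qed

definition coord_op :: "('i \<Rightarrow> 'a::complex_hilbert_space) \<Rightarrow> 'a \<Rightarrow>\<^sub>L 'i ell2" where
  "coord_op e = Blinfun (\<lambda>y. Abs_ell2 (\<lambda>i. cinner y (e i)))"

text \<open>Bessel's inequality makes the coordinates square summable and the coordinate map
  contractive. This validates the uses of \<open>Abs_ell2\<close> and \<open>Blinfun\<close> in
  \<open>coord_op\<close>.\<close>

lemma
  assumes e: "orthonormal_family (e :: 'i \<Rightarrow> 'a::complex_hilbert_space)"
  shows Rep_coord_op: "Rep_ell2 (blinfun_apply (coord_op e) y) i = cinner y (e i)"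
    and norm_coord_op_le: "norm (blinfun_apply (coord_op e) y) \<le> norm y"
proof -
  define W where "W y = Abs_ell2 (\<lambda>i. cinner y (e i))" for y
  have summ: "(\<lambda>i. (cmod (cinner y (e i)))\<^sup>2) summable_on UNIV" for y
    using bessel_inequality[OF e]
    by (intro nonneg_bdd_above_summable_on bdd_aboveI2[where M = "(norm y)\<^sup>2"]) auto
  hence Rep: "Rep_ell2 (W y) = (\<lambda>i. cinner y (e i))" for y
    by (simp add: W_def Abs_ell2_inverse)
  have nW: "norm (W y) \<le> norm y" for y
  proof (rule power2_le_imp_le)
    show "(norm (W y))\<^sup>2 \<le> (norm y)\<^sup>2"
      unfolding norm_ell2_power2 Rep
      using bessel_inequality[OF e] by (intro infsum_le_finite_sums summ) auto
  qed simp
  have "bounded_linear W"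
  proof (rule bounded_linear_intro)
    show "W (x + y) = W x + W y" for x y
      by (simp add: Rep_ell2_inject[symmetric] Rep plus_ell2.rep_eq cinner_add_left)
    show "W (r *\<^sub>R x) = r *\<^sub>R W x" for r x
      by (simp add: Rep_ell2_inject[symmetric] Rep scaleR_ell2.rep_eq scaleR_scaleC cinner_scaleC_left
          scaleC_ell2.rep_eq)
    show "norm (W x) \<le> norm x * 1" for x using nW by simp
  qed
  hence "blinfun_apply (coord_op e) = W"
    unfolding coord_op_def W_def[symmetric] by (rule bounded_linear_Blinfun_apply)
  thus "Rep_ell2 (blinfun_apply (coord_op e) y) i = cinner y (e i)"
    and "norm (blinfun_apply (coord_op e) y) \<le> norm y"
    using nW by (simp_all add: Rep)
qed

lemma coord_op_scaleC:
  assumes "orthonormal_family e"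
  shows "blinfun_apply (coord_op e) (c *\<^sub>C y) = c *\<^sub>C blinfun_apply (coord_op e) y"
  by (simp add: Rep_ell2_inject[symmetric] fun_eq_iff Rep_coord_op[OF assms] scaleC_ell2.rep_eq
      cinner_scaleC_left)

lemma cinner_fock_basis: "cinner x (fock_basis \<alpha>) = Rep_ell2 x \<alpha>"
proof -
  have "cinner x (fock_basis \<alpha>) = (\<Sum>\<^sub>\<infinity>\<beta>. Rep_ell2 x \<beta> * cnj (if \<beta> = \<alpha> then 1 else 0))"
    by (simp add: cinner_ell2.rep_eq fock_basis.rep_eq)
  also have "\<dots> = (\<Sum>\<^sub>\<infinity>\<beta>\<in>{\<alpha>}. Rep_ell2 x \<beta> * cnj (if \<beta> = \<alpha> then 1 else 0))"
    by (rule infsum_cong_neutral) auto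
  finally show ?thesis by simp
qed

lemma coord_op_basis:
  assumes "orthonormal_family e"
  shows "blinfun_apply (coord_op e) (e \<alpha>) = fock_basis \<alpha>"
  using assms
  by (simp add: Rep_ell2_inject[symmetric] fun_eq_iff Rep_coord_op[OF assms] fock_basis.rep_eq
      orthonormal_family_def)

text \<open>The isometry \<open>V\<close> of the introduction, with \<open>coord_op e\<close> as its
  adjoint. Taking an adjoint supplies boundedness without summing an infinite series of
  vectors.\<close>

definition synth_op :: "('i \<Rightarrow> 'a::complex_hilbert_space) \<Rightarrow> 'i ell2 \<Rightarrow>\<^sub>L 'a" where
  "synth_op e = real_adjoint (coord_op e)"

lemma inner_synth_op: "inner y (blinfun_apply (synth_op e) x) = inner (blinfun_apply (coord_op e) y) x"
  by (simp add: synth_op_def inner_real_adjoint)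

text \<open>A real adjoint is a priori just real-linear; complex linearity is inherited from
  \<open>coord_op\<close>.\<close>

lemma synth_op_scaleC:
  assumes "orthonormal_family e"
  shows "blinfun_apply (synth_op e) (c *\<^sub>C x) = c *\<^sub>C blinfun_apply (synth_op e) x"
proof -
  have "inner y (blinfun_apply (synth_op e) (c *\<^sub>C x)) = inner y (c *\<^sub>C blinfun_apply (synth_op e) x)" for y
    using inner_scaleC[of "cnj c" y "blinfun_apply (synth_op e) x"]
      inner_scaleC[of "cnj c" "blinfun_apply (coord_op e) y" x]
    by (simp add: inner_synth_op coord_op_scaleC[OF assms, symmetric])
  thus ?thesis by (metis vector_eq_ldot)
qed

lemma synth_op_basis:
  assumes "orthonormal_family e"
  shows "blinfun_apply (synth_op e) (fock_basis \<alpha>) = e \<alpha>"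
proof -
  have "inner y (blinfun_apply (synth_op e) (fock_basis \<alpha>)) = inner y (e \<alpha>)" for y
    unfolding inner_synth_op by (simp add: inner_cinner cinner_fock_basis Rep_coord_op[OF assms])
  thus ?thesis by (metis vector_eq_ldot)
qed

lemma coord_synth_op:
  fixes x :: "'n fock"
  assumes "orthonormal_family e"
  shows "blinfun_apply (coord_op e) (blinfun_apply (synth_op e) x) = x"
proof -
  have "cinner (blinfun_apply (synth_op e) x) (e \<alpha>) = cinner x (fock_basis \<alpha>)" for \<alpha>
  proof -
    have re: "inner (blinfun_apply (synth_op e) y) (e \<alpha>) = inner y (fock_basis \<alpha>)" for y
      using inner_synth_op[of "e \<alpha>" e y] by (simp add: coord_op_basis[OF assms] inner_commute)
    show ?thesis
      \<comment> \<open>The real product at \<open>x\<close> gives the real part of the complex one,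
        and at \<open>\<i>\<close> times \<open>x\<close> the imaginary part.\<close>
      using re[of x] re[of "\<i> *\<^sub>C x"]
      by (intro complex_eqI) (simp_all add: cinner_Im synth_op_scaleC[OF assms] flip: inner_cinner)
  qed
  thus ?thesis
    by (simp add: Rep_ell2_inject[symmetric] fun_eq_iff Rep_coord_op[OF assms] cinner_fock_basis)
qed

lemma norm_synth_op:
  fixes x :: "'n fock"
  assumes "orthonormal_family e"
  shows "norm (blinfun_apply (synth_op e) x) = norm x"
proof (rule power2_eq_imp_eq)
  show "(norm (blinfun_apply (synth_op e) x))\<^sup>2 = (norm x)\<^sup>2"
    unfolding power2_norm_eq_inner by (simp add: inner_synth_op coord_synth_op[OF assms])
qed simp_all

section \<open>The row of creation operators and its transported copy\<close>

lemma inner_creation_distinct: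
  assumes "i \<noteq> j"
  shows "inner (blinfun_apply (creation i) x) (blinfun_apply (creation j) y) = 0"
proof -
  have *: "creation_coords i f \<alpha> * cnj (creation_coords j g \<alpha>) = 0" for f g \<alpha>
    using assms by (simp add: creation_coords_def split: list.split)
  thus ?thesis
    unfolding inner_ell2.rep_eq creation.rep_eq creation_fun.rep_eq * by simp
qed

lemma norm_creation: "norm (blinfun_apply (creation i) x) = norm x"
  by (simp add: creation.rep_eq norm_creation_fun)

text \<open>The creation operators are isometries with pairwise orthogonal ranges, so their row is
  an isometry.\<close>

lemma norm_row_creation: "norm (blinfun_apply (row_op creation) v) = norm v"
proof (rule power2_eq_imp_eq)
  have "inner (blinfun_apply (creation i) (v $ i)) (blinfun_apply (creation j) (v $ j))
      = (if j = i then (norm (v $ i))\<^sup>2 else 0)" for i j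
    by (auto simp: inner_creation_distinct norm_creation simp flip: power2_norm_eq_inner)
  moreover have "(norm (blinfun_apply (row_op creation) v))\<^sup>2
      = (\<Sum>i\<in>UNIV. \<Sum>j\<in>UNIV. inner (blinfun_apply (creation i) (v $ i)) (blinfun_apply (creation j) (v $ j)))"
    unfolding row_op.rep_eq power2_norm_eq_inner inner_sum_left inner_sum_right by (rule sum.swap)
  ultimately show "(norm (blinfun_apply (row_op creation) v))\<^sup>2 = (norm v)\<^sup>2"
    by (simp add: norm_vec_power2)
qed simp_all

text \<open>The tuple \<open>r V S V\<^sup>*\<close>: a copy of the dilated creation operators on
  the Hilbert space where the map is defined.\<close>

definition dilated_creation ::
    "('n::finite list \<Rightarrow> 'a::complex_hilbert_space) \<Rightarrow> real \<Rightarrow> 'n \<Rightarrow> 'a \<Rightarrow>\<^sub>L 'a" where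
  "dilated_creation e r i = r *\<^sub>R (synth_op e o\<^sub>L creation i o\<^sub>L coord_op e)"

text \<open>The row factors through a coordinatewise contraction, the isometric row of creation
  operators, an isometry and the factor \<open>r\<close>.\<close>

lemma dilated_creation_op_ball:
  fixes e :: "'n::finite list \<Rightarrow> 'a::complex_hilbert_space"
  assumes e: "orthonormal_family e" and r: "0 \<le> r" "r < 1"
  shows "dilated_creation e r \<in> op_ball"
proof -
  have "norm (row_op (dilated_creation e r)) \<le> r"
  proof (rule norm_blinfun_bound)
    fix v :: "'a ^ 'n"
    define w where "w = (\<chi> i. blinfun_apply (coord_op e) (v $ i))"
    have "norm w \<le> norm v"
      unfolding norm_vec_def w_def
      using norm_coord_op_le[OF e] by (intro L2_set_mono) auto
    have "blinfun_apply (row_op (dilated_creation e r)) v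
        = r *\<^sub>R blinfun_apply (synth_op e) (blinfun_apply (row_op creation) w)"
      by (simp add: row_op.rep_eq dilated_creation_def blinfun.scaleR_left w_def blinfun.sum_right
          scaleR_sum_right)
    hence "norm (blinfun_apply (row_op (dilated_creation e r)) v) = r * norm w"
      using r by (simp add: norm_synth_op[OF e] norm_row_creation)
    thus "norm (blinfun_apply (row_op (dilated_creation e r)) v) \<le> r * norm v"
      using \<open>norm w \<le> norm v\<close> r by (simp add: mult_left_mono)
  qed (use r in simp)
  moreover have "dilated_creation e r i \<in> bounded_ops" for i
    using creation_in_bounded_ops[of i]
    by (simp add: bounded_ops_def dilated_creation_def blinfun.scaleR_left coord_op_scaleC[OF e]
        synth_op_scaleC[OF e] scaleC_scaleR)
  ultimately show ?thesis using r by (auto simp: op_ball_iff)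
qed

lemma monomial_intertwine:
  assumes "\<And>i y. blinfun_apply (X i) (blinfun_apply V y) = blinfun_apply V (blinfun_apply (Y i) y)"
  shows "blinfun_apply (monomial X \<alpha>) (blinfun_apply V y) = blinfun_apply V (blinfun_apply (monomial Y \<alpha>) y)"
  by (induction \<alpha>) (simp_all add: monomial_def assms)

text \<open>Used twice: with \<open>synth_op\<close> to move the series to the Fock space, and with
  \<open>right_shift\<close> to obtain commutation.\<close>

lemma homogeneous_part_intertwine:
  assumes "\<And>i y. blinfun_apply (X i) (blinfun_apply V y) = blinfun_apply V (blinfun_apply (Y i) y)"
    and "\<And>c y. blinfun_apply V (c *\<^sub>C y) = c *\<^sub>C blinfun_apply V y"
  shows "blinfun_apply (homogeneous_part a X k) (blinfun_apply V y)
    = blinfun_apply V (blinfun_apply (homogeneous_part a Y k) y)"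
  by (simp add: homogeneous_part_apply monomial_intertwine[of X V Y, OF assms(1)] blinfun.sum_right assms(2))

text \<open>Convergence is known on the given space. Composing with \<open>coord_op e\<close> and
  \<open>synth_op e\<close> preserves it, and the intertwining relation identifies the compressed
  terms.\<close>

lemma homogeneous_part_creation_sums:
  fixes e :: "'n::finite list \<Rightarrow> 'a::complex_hilbert_space"
  assumes exp: "expands a \<phi>" and e: "orthonormal_family e" and r: "0 \<le> r" "r < 1"
  shows "homogeneous_part (a i) (\<lambda>j. r *\<^sub>R creation j)
    sums (coord_op e o\<^sub>L \<phi> (dilated_creation e r) i o\<^sub>L synth_op e)"
proof -
  have "homogeneous_part (a i) (\<lambda>j. r *\<^sub>R creation j) k
      = coord_op e o\<^sub>L homogeneous_part (a i) (dilated_creation e r) k o\<^sub>L synth_op e" for k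
  proof (rule blinfun_eqI)
    fix x
    have "blinfun_apply (homogeneous_part (a i) (dilated_creation e r) k) (blinfun_apply (synth_op e) x)
      = blinfun_apply (synth_op e) (blinfun_apply (homogeneous_part (a i) (\<lambda>j. r *\<^sub>R creation j) k) x)"
      by (rule homogeneous_part_intertwine)
        (simp_all add: dilated_creation_def coord_synth_op[OF e] synth_op_scaleC[OF e]
          blinfun.scaleR_left blinfun.scaleR_right)
    thus "blinfun_apply (homogeneous_part (a i) (\<lambda>j. r *\<^sub>R creation j) k) x =
      blinfun_apply (coord_op e o\<^sub>L homogeneous_part (a i) (dilated_creation e r) k o\<^sub>L synth_op e) x"
      by (simp add: coord_synth_op[OF e])
  qed
  hence "homogeneous_part (a i) (\<lambda>j. r *\<^sub>R creation j)
      = (\<lambda>k. coord_op e o\<^sub>L homogeneous_part (a i) (dilated_creation e r) k o\<^sub>L synth_op e)" by blast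
  moreover have "(homogeneous_part (a i) (dilated_creation e r)) sums \<phi> (dilated_creation e r) i"
    using exp dilated_creation_op_ball[OF e r] by (simp add: expands_def)
  ultimately show ?thesis
    by (simp add: bounded_linear.sums[OF bounded_bilinear.bounded_linear_left[OF bounded_bilinear_blinfun_compose]]
        bounded_linear.sums[OF bounded_bilinear.bounded_linear_right[OF bounded_bilinear_blinfun_compose]])
qed

section \<open>Strong operator limits on the Fock space\<close>

lemma sq_summable_Rep_ell2: "(\<lambda>i. (cmod (Rep_ell2 x i))\<^sup>2) summable_on UNIV"
  using Rep_ell2[of x] by simp

lemma norm_ell2_power2_split:
  assumes "finite F"
  shows "(norm x)\<^sup>2 = (\<Sum>i\<in>F. (cmod (Rep_ell2 x i))\<^sup>2) + (\<Sum>\<^sub>\<infinity>i\<in>-F. (cmod (Rep_ell2 x i))\<^sup>2)"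
proof -
  have "(\<Sum>\<^sub>\<infinity>i\<in>F \<union> -F. (cmod (Rep_ell2 x i))\<^sup>2)
      = (\<Sum>\<^sub>\<infinity>i\<in>F. (cmod (Rep_ell2 x i))\<^sup>2) + (\<Sum>\<^sub>\<infinity>i\<in>-F. (cmod (Rep_ell2 x i))\<^sup>2)"
    by (rule infsum_Un_disjoint)
      (use assms summable_on_subset_banach[OF sq_summable_Rep_ell2[of x]] in auto)
  thus ?thesis using assms by (simp add: norm_ell2_power2)
qed

lemma ell2_tail_small:
  assumes "0 < \<epsilon>"
  obtains F where "finite F" "(\<Sum>\<^sub>\<infinity>i\<in>-F. (cmod (Rep_ell2 x i))\<^sup>2) < \<epsilon>"
proof -
  have "((\<lambda>i. (cmod (Rep_ell2 x i))\<^sup>2) has_sum (norm x)\<^sup>2) UNIV"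
    unfolding norm_ell2_power2 using sq_summable_Rep_ell2 by (rule has_sum_infsum)
  hence "eventually (\<lambda>F. dist (\<Sum>i\<in>F. (cmod (Rep_ell2 x i))\<^sup>2) ((norm x)\<^sup>2) < \<epsilon>) (finite_subsets_at_top UNIV)"
    unfolding has_sum_def using assms by (rule tendstoD)
  then obtain F where F: "finite F" "dist (\<Sum>i\<in>F. (cmod (Rep_ell2 x i))\<^sup>2) ((norm x)\<^sup>2) < \<epsilon>"
    unfolding eventually_finite_subsets_at_top by auto
  thus thesis
    using that[of F] norm_ell2_power2_split[of F x] by (simp add: dist_real_def)
qed

lemma Rep_ell2_sum: "Rep_ell2 (\<Sum>i\<in>F. f i) j = (\<Sum>i\<in>F. Rep_ell2 (f i) j)"
  by (induction F rule: infinite_finite_induct) (auto simp: zero_ell2.rep_eq plus_ell2.rep_eq)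

text \<open>Finite truncations approximate every vector. Facts about bounded operators on the Fock
  space thereby reduce to basis vectors.\<close>

lemma fock_dense:
  fixes A :: "'n fock set"
  assumes closed: "closed A" and basis: "\<And>\<alpha>. fock_basis \<alpha> \<in> A"
    and add: "\<And>x y. x \<in> A \<Longrightarrow> y \<in> A \<Longrightarrow> x + y \<in> A"
    and scale: "\<And>c x. x \<in> A \<Longrightarrow> c *\<^sub>C x \<in> A"
  shows "x \<in> A"
proof -
  have "\<exists>y\<in>A. dist y x < \<epsilon>" if pos: "0 < \<epsilon>" for \<epsilon>
  proof -
    obtain F where F: "finite F" "(\<Sum>\<^sub>\<infinity>i\<in>-F. (cmod (Rep_ell2 x i))\<^sup>2) < \<epsilon>\<^sup>2"
      using ell2_tail_small[of "\<epsilon>\<^sup>2" x, OF zero_less_power[OF pos]] by blast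
    \<comment> \<open>The truncation of \<open>x\<close> to \<open>F\<close>. That it lies in
      \<open>A\<close> needs 0 as a starting value, which is a multiple of a basis vector.\<close>
    define y where "y = (\<Sum>\<alpha>\<in>F. Rep_ell2 x \<alpha> *\<^sub>C fock_basis \<alpha>)"
    have "0 *\<^sub>C fock_basis [] \<in> A" by (intro scale basis)
    hence "0 \<in> A" by simp
    have "y \<in> A"
      unfolding y_def using F(1) by (induction F) (use \<open>0 \<in> A\<close> in \<open>auto intro!: add scale basis\<close>)
    have Rep: "Rep_ell2 (y - x) \<alpha> = (if \<alpha> \<in> F then 0 else - Rep_ell2 x \<alpha>)" for \<alpha>
      using F(1) by (simp add: y_def minus_ell2.rep_eq Rep_ell2_sum scaleC_ell2.rep_eq fock_basis.rep_eq
          if_distrib[of "(*) _"] cong: if_cong)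
    have "(norm (y - x))\<^sup>2 = (\<Sum>\<^sub>\<infinity>i\<in>-F. (cmod (Rep_ell2 x i))\<^sup>2)"
      unfolding norm_ell2_power2_split[OF F(1)] Rep
      by (simp, intro infsum_cong) simp
    hence "norm (y - x) < \<epsilon>" using F(2) pos by (simp add: power2_less_imp_less)
    thus ?thesis using \<open>y \<in> A\<close> by (auto simp: dist_norm)
  qed
  thus ?thesis using closed closure_approachable[of x A] by simp
qed

section \<open>Right shifts and their commutation with left creation operators\<close>

lemma monomial_creation_basis:
  "blinfun_apply (monomial creation \<alpha>) (fock_basis \<beta>) = fock_basis (\<alpha> @ \<beta>)"
  by (induction \<alpha>) (simp_all add: monomial_def creation_fock_basis)

text \<open>Appends \<open>\<beta>\<close> to every word. The right translates of the basis are
  orthonormal, so the construction of isometries applies.\<close>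

definition right_shift :: "'n::finite list \<Rightarrow> 'n fock \<Rightarrow>\<^sub>L 'n fock" where
  "right_shift \<beta> = synth_op (\<lambda>\<alpha>. fock_basis (\<alpha> @ \<beta>))"

lemma orthonormal_right_translates: "orthonormal_family (\<lambda>\<alpha>. fock_basis (\<alpha> @ \<beta>))"
  by (simp add: orthonormal_family_def cinner_fock_basis fock_basis.rep_eq)

lemma right_shift_basis: "blinfun_apply (right_shift \<beta>) (fock_basis \<alpha>) = fock_basis (\<alpha> @ \<beta>)"
  unfolding right_shift_def by (rule synth_op_basis[OF orthonormal_right_translates])

lemma right_shift_scaleC: "blinfun_apply (right_shift \<beta>) (c *\<^sub>C x) = c *\<^sub>C blinfun_apply (right_shift \<beta>) x"
  unfolding right_shift_def by (rule synth_op_scaleC[OF orthonormal_right_translates])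

text \<open>Prepending a letter and appending a word commute on basis vectors; density extends this
  to all vectors.\<close>

lemma creation_right_shift:
  "blinfun_apply (creation i) (blinfun_apply (right_shift \<beta>) x)
    = blinfun_apply (right_shift \<beta>) (blinfun_apply (creation i) x)"
proof -
  define A where "A = {x. blinfun_apply (creation i) (blinfun_apply (right_shift \<beta>) x)
    = blinfun_apply (right_shift \<beta>) (blinfun_apply (creation i) x)}"
  have "x \<in> A"
  proof (rule fock_dense)
    show "closed A" unfolding A_def
      by (intro closed_Collect_eq continuous_intros)
  qed (use creation_in_bounded_ops[of i] in
      \<open>auto simp: A_def blinfun.add_right right_shift_basis creation_fock_basis right_shift_scaleC bounded_ops_def\<close>)
  thus ?thesis by (simp add: A_def)
qed

text \<open>The strong operator topology is the pullback of the product topology along evaluation,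
  where limits are pointwise.\<close>

lemma strong_limit_iff:
  "limitin strong_operator_topology f T F \<longleftrightarrow> (\<forall>x. ((\<lambda>r. blinfun_apply (f r) x) \<longlongrightarrow> blinfun_apply T x) F)"
proof
  assume L: "limitin strong_operator_topology f T F"
  show "\<forall>x. ((\<lambda>r. blinfun_apply (f r) x) \<longlongrightarrow> blinfun_apply T x) F"
    using continuous_map_limit[OF strong_operator_topology_continuous_evaluation L] by (simp add: o_def)
next
  assume L: "\<forall>x. ((\<lambda>r. blinfun_apply (f r) x) \<longlongrightarrow> blinfun_apply T x) F"
  have "limitin euclidean (\<lambda>r. blinfun_apply (f r)) (blinfun_apply T) F"
    unfolding euclidean_product_topology[symmetric] limitin_componentwise using L by simp
  hence "eventually (\<lambda>r. blinfun_apply (f r) \<in> V) F" if "open V" "blinfun_apply T \<in> V" for V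
    using that by (simp add: topological_tendstoD)
  thus "limitin strong_operator_topology f T F"
    by (auto simp: limitin_def strong_operator_topology_topspace strong_operator_topology_def
        openin_pullback_topology topspace_pullback_topology)
qed

text \<open>A Banach--Steinhaus argument: for uniform contractions the vectors with a limit form a
  closed complex subspace, so convergence on the basis suffices. Bounds are required eventually
  because they will hold for \<open>r\<close> in \<open>[0, 1)\<close>.\<close>

lemma pointwise_limit_on_fock:
  fixes G :: "real \<Rightarrow> 'n fock \<Rightarrow>\<^sub>L 'b::complex_hilbert_space"
  assumes bnd: "eventually (\<lambda>r. norm (G r) \<le> 1) F" and ntriv: "F \<noteq> bot"
    and lin: "eventually (\<lambda>r. \<forall>c x. blinfun_apply (G r) (c *\<^sub>C x) = c *\<^sub>C blinfun_apply (G r) x) F"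
    and basis: "\<And>\<alpha>. \<exists>l. ((\<lambda>r. blinfun_apply (G r) (fock_basis \<alpha>)) \<longlongrightarrow> l) F"
  obtains T where "\<And>x. ((\<lambda>r. blinfun_apply (G r) x) \<longlongrightarrow> blinfun_apply T x) F"
proof -
  have G: "eventually (\<lambda>r. norm (blinfun_apply (G r) x) \<le> norm x) F" for x
    using bnd
  proof eventually_elim
    case (elim r)
    thus ?case using norm_blinfun[of "G r" x] mult_right_mono[OF elim norm_ge_zero[of x]] by simp
  qed
  define A where "A = {x. \<exists>l. ((\<lambda>r. blinfun_apply (G r) x) \<longlongrightarrow> l) F}"
  have A: "x \<in> A" for x
  proof (rule fock_dense)
    show "closed A"
    proof (rule closed_sequential_limits[THEN iffD2], intro allI impI, elim conjE)
      fix X x assume "\<forall>n. X n \<in> A" and X: "X \<longlonglongrightarrow> x"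
      hence "\<forall>n. \<exists>l. ((\<lambda>r. blinfun_apply (G r) (X n)) \<longlongrightarrow> l) F" by (simp add: A_def)
      from choice[OF this] obtain l where l: "\<And>n. ((\<lambda>r. blinfun_apply (G r) (X n)) \<longlongrightarrow> l n) F"
        by blast
      \<comment> \<open>Contractivity survives in the limit, so the limits at a convergent sequence
        of vectors form a Cauchy sequence.\<close>
      have d: "dist (l m) (l n) \<le> dist (X m) (X n)" for m n
      proof -
        have "((\<lambda>r. norm (blinfun_apply (G r) (X m - X n))) \<longlongrightarrow> norm (l m - l n)) F"
          unfolding blinfun.diff_right by (intro tendsto_intros l)
        thus ?thesis
          unfolding dist_norm using G[of "X m - X n"] by (rule tendsto_upperbound[OF _ _ ntriv])
      qed
      have "Cauchy l"
      proof (rule metric_CauchyI)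
        fix \<epsilon> :: real assume "0 < \<epsilon>"
        then obtain M where "\<forall>m\<ge>M. \<forall>n\<ge>M. dist (X m) (X n) < \<epsilon>"
          using metric_CauchyD[OF LIMSEQ_imp_Cauchy[OF X] \<open>0 < \<epsilon>\<close>] by auto
        hence "\<forall>m\<ge>M. \<forall>n\<ge>M. dist (l m) (l n) < \<epsilon>" using le_less_trans[OF d] by simp
        thus "\<exists>M. \<forall>m\<ge>M. \<forall>n\<ge>M. dist (l m) (l n) < \<epsilon>" ..
      qed
      then obtain L where L: "l \<longlonglongrightarrow> L" using Cauchy_convergent convergent_def by blast
      \<comment> \<open>Uniformity in all contractive parameters permits interchanging the limit
        along the vectors with the limit along \<open>F\<close>.\<close>
      have unif: "uniform_limit {r. norm (G r) \<le> 1} (\<lambda>n r. blinfun_apply (G r) (X n)) (\<lambda>r. blinfun_apply (G r) x) sequentially"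
      proof (rule uniform_limitI)
        fix \<epsilon> :: real assume "0 < \<epsilon>"
        hence "eventually (\<lambda>n. dist (X n) x < \<epsilon>) sequentially" by (rule tendstoD[OF X])
        thus "\<forall>\<^sub>F n in sequentially. \<forall>r\<in>{r. norm (G r) \<le> 1}. dist (blinfun_apply (G r) (X n)) (blinfun_apply (G r) x) < \<epsilon>"
        proof eventually_elim
          case (elim n)
          have "dist (blinfun_apply (G r) (X n)) (blinfun_apply (G r) x) \<le> dist (X n) x" if "norm (G r) \<le> 1" for r
            using norm_blinfun[of "G r" "X n - x"] mult_right_mono[OF that norm_ge_zero[of "X n - x"]]
            by (simp add: dist_norm blinfun.diff_right)
          thus ?case using le_less_trans[OF _ elim] by simp
        qed
      qed
      have "((\<lambda>r. blinfun_apply (G r) x) \<longlongrightarrow> L) F"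
        by (rule swap_uniform_limit'[OF _ L unif]) (use l bnd in auto)
      thus "x \<in> A" by (auto simp: A_def)
    qed
  next
    show "x + y \<in> A" if "x \<in> A" "y \<in> A" for x y
      using that tendsto_add unfolding A_def mem_Collect_eq blinfun.add_right by blast
    show "c *\<^sub>C x \<in> A" if x: "x \<in> A" for c x
    proof -
      obtain l where l: "((\<lambda>r. blinfun_apply (G r) x) \<longlongrightarrow> l) F" using x by (auto simp: A_def)
      have "((\<lambda>r. blinfun_apply (scalar_op c) (blinfun_apply (G r) x)) \<longlongrightarrow> blinfun_apply (scalar_op c) l) F"
        by (intro tendsto_intros l)
      moreover have "\<forall>\<^sub>F r in F. blinfun_apply (scalar_op c) (blinfun_apply (G r) x) = blinfun_apply (G r) (c *\<^sub>C x)"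
        using lin by eventually_elim (simp add: scalar_op.rep_eq)
      ultimately have "((\<lambda>r. blinfun_apply (G r) (c *\<^sub>C x)) \<longlongrightarrow> blinfun_apply (scalar_op c) l) F"
        by (rule Lim_transform_eventually)
      thus ?thesis by (auto simp: A_def)
    qed
  qed (use basis in \<open>auto simp: A_def\<close>)
  hence "\<forall>x. \<exists>l. ((\<lambda>r. blinfun_apply (G r) x) \<longlongrightarrow> l) F" by (simp add: A_def)
  from choice[OF this] obtain t where t: "\<And>x. ((\<lambda>r. blinfun_apply (G r) x) \<longlongrightarrow> t x) F"
    by blast
  have "bounded_linear t"
  proof (rule bounded_linear_intro)
    show "t (x + y) = t x + t y" for x y
      using t[of "x + y"] tendsto_add[OF t[of x] t[of y]] unfolding blinfun.add_right
      by (rule tendsto_unique[OF ntriv])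
    show "t (c *\<^sub>R x) = c *\<^sub>R t x" for c x
      using t[of "c *\<^sub>R x"] tendsto_scaleR[OF tendsto_const t[of x]] unfolding blinfun.scaleR_right
      by (rule tendsto_unique[OF ntriv])
    show "norm (t x) \<le> norm x * 1" for x
      using tendsto_upperbound[OF tendsto_norm[OF t[of x]] G ntriv] by simp
  qed
  thus thesis using that[of "Blinfun t"] t by (simp add: bounded_linear_Blinfun_apply)
qed

text \<open>Letting \<open>r\<close> tend to 1 in finite partial sums shows that \<open>a\<close> is
  square summable. Convergence then follows from a finite set of words and a tail dominated by that
  of \<open>a\<close>.\<close>

lemma radial_limit_ell2:
  fixes u :: "real \<Rightarrow> 'n list ell2" and a :: "'n list \<Rightarrow> complex"
  assumes coef: "\<And>r \<alpha>. 0 \<le> r \<Longrightarrow> r < 1 \<Longrightarrow> Rep_ell2 (u r) \<alpha> = complex_of_real (r ^ length \<alpha>) * a \<alpha>"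
    and bnd: "\<And>r. 0 \<le> r \<Longrightarrow> r < 1 \<Longrightarrow> norm (u r) \<le> 1"
  obtains L where "(u \<longlongrightarrow> L) (at_left 1)" "Rep_ell2 L = a"
proof -
  have ev: "eventually (\<lambda>r :: real. 0 \<le> r \<and> r < 1) (at_left 1)"
    using eventually_at_left_real[of 0 "1::real"] by (auto elim: eventually_mono)
  have "(\<Sum>\<alpha>\<in>F. (cmod (a \<alpha>))\<^sup>2) \<le> 1" if "finite F" for F
  proof (rule tendsto_upperbound)
    have "((\<lambda>r. \<Sum>\<alpha>\<in>F. (r ^ length \<alpha>)\<^sup>2 * (cmod (a \<alpha>))\<^sup>2)
        \<longlongrightarrow> (\<Sum>\<alpha>\<in>F. (1 ^ length \<alpha>)\<^sup>2 * (cmod (a \<alpha>))\<^sup>2)) (at_left 1)"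
      by (intro tendsto_intros)
    thus "((\<lambda>r. \<Sum>\<alpha>\<in>F. (r ^ length \<alpha>)\<^sup>2 * (cmod (a \<alpha>))\<^sup>2) \<longlongrightarrow> (\<Sum>\<alpha>\<in>F. (cmod (a \<alpha>))\<^sup>2)) (at_left 1)"
      by simp
    show "\<forall>\<^sub>F r in at_left 1. (\<Sum>\<alpha>\<in>F. (r ^ length \<alpha>)\<^sup>2 * (cmod (a \<alpha>))\<^sup>2) \<le> 1"
      using ev
    proof eventually_elim
      case (elim r)
      hence "(\<Sum>\<alpha>\<in>F. (r ^ length \<alpha>)\<^sup>2 * (cmod (a \<alpha>))\<^sup>2) = (\<Sum>\<alpha>\<in>F. (cmod (Rep_ell2 (u r) \<alpha>))\<^sup>2)"
        by (simp add: coef norm_mult power_mult_distrib norm_power)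
      also have "\<dots> \<le> (norm (u r))\<^sup>2" by (rule sum_le_norm_ell2[OF that])
      also have "\<dots> \<le> 1" using bnd elim by (simp add: abs_square_le_1)
      finally show ?case .
    qed
  qed simp
  hence "(\<lambda>\<alpha>. (cmod (a \<alpha>))\<^sup>2) summable_on UNIV"
    by (intro nonneg_bdd_above_summable_on bdd_aboveI2[where M = 1]) auto
  then obtain L where L: "Rep_ell2 L = a" using Abs_ell2_inverse by blast
  have "(u \<longlongrightarrow> L) (at_left 1)"
  proof (rule tendstoI)
    fix \<epsilon> :: real assume \<epsilon>: "0 < \<epsilon>"
    \<comment> \<open>Half of the allowed error is spent on the tail, uniformly in \<open>r\<close>;
      the finite part takes the other half as \<open>r\<close> approaches 1.\<close>
    obtain F where F: "finite F" "(\<Sum>\<^sub>\<infinity>i\<in>-F. (cmod (a i))\<^sup>2) < \<epsilon>\<^sup>2 / 2"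
      using ell2_tail_small[of "\<epsilon>\<^sup>2 / 2" L, unfolded L, OF half_gt_zero[OF zero_less_power[OF \<epsilon>]]]
      by blast
    have "((\<lambda>r. \<Sum>\<alpha>\<in>F. (1 - r ^ length \<alpha>)\<^sup>2 * (cmod (a \<alpha>))\<^sup>2)
        \<longlongrightarrow> (\<Sum>\<alpha>\<in>F. (1 - 1 ^ length \<alpha>)\<^sup>2 * (cmod (a \<alpha>))\<^sup>2)) (at_left 1)"
      by (intro tendsto_intros)
    hence "((\<lambda>r. \<Sum>\<alpha>\<in>F. (1 - r ^ length \<alpha>)\<^sup>2 * (cmod (a \<alpha>))\<^sup>2) \<longlongrightarrow> 0) (at_left 1)"
      by simp
    hence "eventually (\<lambda>r. (\<Sum>\<alpha>\<in>F. (1 - r ^ length \<alpha>)\<^sup>2 * (cmod (a \<alpha>))\<^sup>2) < \<epsilon>\<^sup>2 / 2) (at_left 1)"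
      using \<epsilon> by (intro order_tendstoD(2)) auto
    with ev show "eventually (\<lambda>r. dist (u r) L < \<epsilon>) (at_left 1)"
    proof eventually_elim
      case (elim r)
      hence r: "0 \<le> r" "r < 1" by auto
      have c: "(cmod (Rep_ell2 (u r - L) \<alpha>))\<^sup>2 = (1 - r ^ length \<alpha>)\<^sup>2 * (cmod (a \<alpha>))\<^sup>2" for \<alpha>
      proof -
        have "Rep_ell2 (u r - L) \<alpha> = complex_of_real (r ^ length \<alpha> - 1) * a \<alpha>"
          using r by (simp add: minus_ell2.rep_eq coef L algebra_simps)
        hence "cmod (Rep_ell2 (u r - L) \<alpha>) = \<bar>r ^ length \<alpha> - 1\<bar> * cmod (a \<alpha>)"
          by (simp only: norm_mult norm_of_real)
        thus ?thesis by (simp add: power_mult_distrib power2_commute)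
      qed
      have "(\<Sum>\<^sub>\<infinity>\<alpha>\<in>-F. (cmod (Rep_ell2 (u r - L) \<alpha>))\<^sup>2) \<le> (\<Sum>\<^sub>\<infinity>\<alpha>\<in>-F. (cmod (a \<alpha>))\<^sup>2)"
      proof (rule infsum_mono)
        show "(\<lambda>\<alpha>. (cmod (Rep_ell2 (u r - L) \<alpha>))\<^sup>2) summable_on - F"
          by (rule summable_on_subset_banach[OF sq_summable_Rep_ell2]) simp
        show "(\<lambda>\<alpha>. (cmod (a \<alpha>))\<^sup>2) summable_on - F"
          using summable_on_subset_banach[OF sq_summable_Rep_ell2[of L]] by (simp add: L)
        show "(cmod (Rep_ell2 (u r - L) \<alpha>))\<^sup>2 \<le> (cmod (a \<alpha>))\<^sup>2" for \<alpha>
        proof -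
          have "(1 - r ^ length \<alpha>)\<^sup>2 \<le> 1" using r by (simp add: abs_square_le_1 power_le_one)
          thus ?thesis unfolding c by (simp add: mult_left_le_one_le)
        qed
      qed
      hence "(norm (u r - L))\<^sup>2 < \<epsilon>\<^sup>2"
        using norm_ell2_power2_split[OF F(1), of "u r - L"] F(2) elim unfolding c by argo
      thus ?case using \<epsilon> by (simp add: dist_norm power2_less_imp_less)
    qed
  qed
  thus thesis using that L by blast
qed

section \<open>Boundary functions\<close>

lemma norm_axis_vec: "norm (axis i x :: 'a::real_normed_vector ^ 'n::finite) = norm x"
proof (rule power2_eq_imp_eq)
  show "(norm (axis i x :: 'a ^ 'n))\<^sup>2 = (norm x)\<^sup>2"
    unfolding norm_vec_power2 by (rule sum_axis) simp
qed simp_all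

lemma norm_component_le_row_op: "norm (T i) \<le> norm (row_op T)"
proof (rule norm_blinfun_bound)
  show "norm (blinfun_apply (T i) x) \<le> norm (row_op T) * norm x" for x
    using norm_blinfun[of "row_op T" "axis i x"] by (simp add: row_op_axis norm_axis_vec)
qed simp

lemma finite_words: "finite {\<alpha> :: 'n::finite list. length \<alpha> = k}"
  using finite_lists_length_eq[of "UNIV :: 'n set" k] by simp

lemma eventually_at_left_one: "eventually (\<lambda>r :: real. 0 \<le> r \<and> r < 1) (at_left 1)"
  using eventually_at_left_real[of 0 "1::real"] by (auto elim: eventually_mono)

section \<open>Evaluation at dilated creation operators and passage to the boundary\<close>

text \<open>The family \<open>e\<close> is an auxiliary choice of embedding;
  \<open>boundary_function\<close> is defined without it.\<close>

locale contractive_free_map =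
  fixes \<phi> :: "('n::finite \<Rightarrow> 'h::complex_hilbert_space \<Rightarrow>\<^sub>L 'h) \<Rightarrow> 'm::finite \<Rightarrow> 'h \<Rightarrow>\<^sub>L 'h"
    and e :: "'n list \<Rightarrow> 'h"
  assumes holo: "free_holomorphic_map \<phi>"
    and maps: "\<phi> ` op_ball \<subseteq> op_cball"
    and e: "orthonormal_family e"
begin

text \<open>The same choice of coefficients as in \<open>boundary_function\<close>, so both speak of
  one series.\<close>

definition coeff :: "'m \<Rightarrow> 'n list \<Rightarrow> complex" where
  "coeff i = free_coeff (\<lambda>X. \<phi> X i)"

lemma coeff_expands: "expands coeff \<phi>"
proof -
  have "\<exists>a. free_expansion (\<lambda>X. \<phi> X i) a" for i
    using holo by (simp add: free_holomorphic_map_def free_holomorphic_def)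
  hence "free_expansion (\<lambda>X. \<phi> X i) (coeff i)" for i
    unfolding coeff_def free_coeff_def by (rule someI_ex)
  thus ?thesis by (simp add: expands_def free_expansion_def)
qed

lemma norm_row_le: "X \<in> op_ball \<Longrightarrow> norm (row_op (\<phi> X)) \<le> 1"
  using maps by (auto simp: op_cball_iff)

lemma value_in_bounded_ops: "X \<in> op_ball \<Longrightarrow> \<phi> X i \<in> bounded_ops"
  using maps by (auto simp: op_cball_iff)

text \<open>The value at \<open>r S\<close>, defined by compression so that it inherits
  contractivity from \<open>\<phi>\<close>; the next lemma identifies it with the series.\<close>

definition fock_value :: "real \<Rightarrow> 'm \<Rightarrow> 'n fock \<Rightarrow>\<^sub>L 'n fock" where
  "fock_value r i = coord_op e o\<^sub>L \<phi> (dilated_creation e r) i o\<^sub>L synth_op e"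

lemma fock_value_sums:
  assumes "0 \<le> r" "r < 1"
  shows "homogeneous_part (coeff i) (\<lambda>j. r *\<^sub>R creation j) sums fock_value r i"
  unfolding fock_value_def by (rule homogeneous_part_creation_sums[OF coeff_expands e assms])

lemma norm_row_fock_value:
  assumes "0 \<le> r" "r < 1"
  shows "norm (row_op (fock_value r)) \<le> 1"
proof (rule norm_blinfun_bound)
  fix v :: "'n fock ^ 'm"
  let ?T = "row_op (\<phi> (dilated_creation e r))"
  define w where "w = (\<chi> i. blinfun_apply (synth_op e) (v $ i))"
  have w: "norm w = norm v" by (simp add: norm_vec_def w_def norm_synth_op[OF e])
  have "blinfun_apply (row_op (fock_value r)) v = blinfun_apply (coord_op e) (blinfun_apply ?T w)"
    by (simp add: row_op.rep_eq fock_value_def w_def blinfun.sum_right)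
  hence "norm (blinfun_apply (row_op (fock_value r)) v) \<le> norm (blinfun_apply ?T w)"
    using norm_coord_op_le[OF e] by simp
  also have "\<dots> \<le> norm ?T * norm w" by (rule norm_blinfun)
  also have "\<dots> \<le> 1 * norm w"
    by (intro mult_right_mono norm_row_le dilated_creation_op_ball[OF e assms]) simp
  finally show "norm (blinfun_apply (row_op (fock_value r)) v) \<le> 1 * norm v" by (simp add: w)
qed simp

lemma norm_fock_value:
  assumes "0 \<le> r" "r < 1"
  shows "norm (fock_value r i) \<le> 1"
  using norm_component_le_row_op norm_row_fock_value[OF assms] by (rule order_trans)

lemma fock_value_scaleC:
  assumes "0 \<le> r" "r < 1"
  shows "blinfun_apply (fock_value r i) (c *\<^sub>C x) = c *\<^sub>C blinfun_apply (fock_value r i) x"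
  using value_in_bounded_ops[OF dilated_creation_op_ball[OF e assms], of i]
  by (simp add: fock_value_def coord_op_scaleC[OF e] synth_op_scaleC[OF e] bounded_ops_def)

lemma fock_value_apply_sums:
  assumes "0 \<le> r" "r < 1"
  shows "(\<lambda>k. blinfun_apply (homogeneous_part (coeff i) (\<lambda>j. r *\<^sub>R creation j) k) x)
    sums blinfun_apply (fock_value r i) x"
  by (rule bounded_linear.sums[OF blinfun.bounded_linear_left fock_value_sums[OF assms]])

text \<open>Each homogeneous part is a polynomial in left creation operators, which commute with
  right shifts; the relation passes to the sum.\<close>

lemma fock_value_right_shift:
  assumes "0 \<le> r" "r < 1"
  shows "blinfun_apply (fock_value r i) (blinfun_apply (right_shift \<beta>) x)
    = blinfun_apply (right_shift \<beta>) (blinfun_apply (fock_value r i) x)"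
proof -
  have "blinfun_apply (homogeneous_part (coeff i) (\<lambda>j. r *\<^sub>R creation j) k) (blinfun_apply (right_shift \<beta>) x)
      = blinfun_apply (right_shift \<beta>) (blinfun_apply (homogeneous_part (coeff i) (\<lambda>j. r *\<^sub>R creation j) k) x)" for k
    by (rule homogeneous_part_intertwine)
      (simp_all add: blinfun.scaleR_left blinfun.scaleR_right creation_right_shift right_shift_scaleC)
  with fock_value_apply_sums[OF assms, of i "blinfun_apply (right_shift \<beta>) x"]
  have "(\<lambda>k. blinfun_apply (right_shift \<beta>) (blinfun_apply (homogeneous_part (coeff i) (\<lambda>j. r *\<^sub>R creation j) k) x))
    sums blinfun_apply (fock_value r i) (blinfun_apply (right_shift \<beta>) x)" by simp
  from sums_unique2[OF this bounded_linear.sums[OF blinfun.bounded_linear_right fock_value_apply_sums[OF assms]]]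
  show ?thesis .
qed

text \<open>A monomial sends the vacuum to the basis vector of its own word, so the coordinate at
  \<open>\<alpha>\<close> receives a contribution from degree \<open>length \<alpha>\<close>
  alone.\<close>

lemma Rep_fock_value_vacuum:
  assumes "0 \<le> r" "r < 1"
  shows "Rep_ell2 (blinfun_apply (fock_value r i) (fock_basis [])) \<alpha>
    = complex_of_real (r ^ length \<alpha>) * coeff i \<alpha>"
proof -
  have "(\<lambda>k. cinner (blinfun_apply (homogeneous_part (coeff i) (\<lambda>j. r *\<^sub>R creation j) k) (fock_basis [])) (fock_basis \<alpha>))
      sums cinner (blinfun_apply (fock_value r i) (fock_basis [])) (fock_basis \<alpha>)"
    by (rule bounded_linear.sums[OF bounded_linear_cinner_left fock_value_apply_sums[OF assms]])
  moreover have "cinner (blinfun_apply (homogeneous_part (coeff i) (\<lambda>j. r *\<^sub>R creation j) k) (fock_basis [])) (fock_basis \<alpha>)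
      = (if k = length \<alpha> then complex_of_real (r ^ length \<alpha>) * coeff i \<alpha> else 0)" for k
  proof -
    have "homogeneous_part (coeff i) (\<lambda>j. r *\<^sub>R creation j) k
        = scalar_op (complex_of_real r ^ k) o\<^sub>L homogeneous_part (coeff i) creation k"
      unfolding cscale_of_real[symmetric]
      by (rule homogeneous_part_cscale) (rule creation_in_bounded_ops)
    hence "cinner (blinfun_apply (homogeneous_part (coeff i) (\<lambda>j. r *\<^sub>R creation j) k) (fock_basis [])) (fock_basis \<alpha>)
        = complex_of_real r ^ k * (\<Sum>\<beta> | length \<beta> = k. coeff i \<beta> * (if \<alpha> = \<beta> then 1 else 0))"
      by (simp add: homogeneous_part_apply scalar_op.rep_eq cinner_scaleC_left cinner_sum_left
          monomial_creation_basis cinner_fock_basis fock_basis.rep_eq Rep_ell2_sum scaleC_ell2.rep_eq)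
    also have "(\<Sum>\<beta> | length \<beta> = k. coeff i \<beta> * (if \<alpha> = \<beta> then 1 else 0))
        = (if length \<alpha> = k then coeff i \<alpha> else 0)"
      by (simp add: sum.delta'[OF finite_words] if_distrib[of "(*) _"] cong: if_cong)
    finally show ?thesis by auto
  qed
  ultimately have "(\<lambda>k. if k = length \<alpha> then complex_of_real (r ^ length \<alpha>) * coeff i \<alpha> else 0)
      sums cinner (blinfun_apply (fock_value r i) (fock_basis [])) (fock_basis \<alpha>)"
    by simp
  from sums_unique2[OF this sums_single[of "length \<alpha>" "\<lambda>_. complex_of_real (r ^ length \<alpha>) * coeff i \<alpha>"]]
  show ?thesis by (simp add: cinner_fock_basis)
qed

lemma fock_value_vacuum_limit:
  obtains L where "((\<lambda>r. blinfun_apply (fock_value r i) (fock_basis [])) \<longlongrightarrow> L) (at_left 1)"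
    and "Rep_ell2 L = coeff i"
proof (rule radial_limit_ell2[of "\<lambda>r. blinfun_apply (fock_value r i) (fock_basis [])" "coeff i"])
  fix r :: real assume r: "0 \<le> r" "r < 1"
  show "Rep_ell2 (blinfun_apply (fock_value r i) (fock_basis [])) \<alpha>
      = complex_of_real (r ^ length \<alpha>) * coeff i \<alpha>" for \<alpha>
    by (rule Rep_fock_value_vacuum[OF r])
  \<comment> \<open>The vacuum is a unit vector, so contractivity gives the uniform bound 1.\<close>
  have "(norm (fock_basis [] :: 'n fock))\<^sup>2 = Re (cinner (fock_basis []) (fock_basis [] :: 'n fock))"
    by (simp add: cinner_self)
  hence "(norm (fock_basis [] :: 'n fock))\<^sup>2 = 1\<^sup>2"
    by (simp add: cinner_fock_basis fock_basis.rep_eq)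
  hence "norm (fock_basis [] :: 'n fock) = 1" by (rule power2_eq_imp_eq) simp_all
  thus "norm (blinfun_apply (fock_value r i) (fock_basis [])) \<le> 1"
    using norm_blinfun[of "fock_value r i" "fock_basis []"] norm_fock_value[OF r, of i] by simp
qed

text \<open>Shows that the strong limit defining \<open>boundary_function\<close> exists and is
  unique. A basis vector is a right shift of the vacuum, so convergence at the vacuum spreads to the
  basis and then to all vectors.\<close>

lemma fock_value_tendsto_boundary:
  "((\<lambda>r. blinfun_apply (fock_value r i) x) \<longlongrightarrow> blinfun_apply (boundary_function \<phi> i) x) (at_left 1)"
proof -
  have basis: "\<exists>l. ((\<lambda>r. blinfun_apply (fock_value r i) (fock_basis \<alpha>)) \<longlongrightarrow> l) (at_left 1)" for \<alpha>
  proof -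
    obtain L where L: "((\<lambda>r. blinfun_apply (fock_value r i) (fock_basis [])) \<longlongrightarrow> L) (at_left 1)"
      using fock_value_vacuum_limit by blast
    have "((\<lambda>r. blinfun_apply (right_shift \<alpha>) (blinfun_apply (fock_value r i) (fock_basis [])))
        \<longlongrightarrow> blinfun_apply (right_shift \<alpha>) L) (at_left 1)"
      by (intro tendsto_intros L)
    moreover have "\<forall>\<^sub>F r in at_left 1.
        blinfun_apply (right_shift \<alpha>) (blinfun_apply (fock_value r i) (fock_basis []))
        = blinfun_apply (fock_value r i) (fock_basis \<alpha>)"
      using eventually_at_left_one
      by eventually_elim (simp add: right_shift_basis flip: fock_value_right_shift)
    ultimately have "((\<lambda>r. blinfun_apply (fock_value r i) (fock_basis \<alpha>))
        \<longlongrightarrow> blinfun_apply (right_shift \<alpha>) L) (at_left 1)"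
      by (rule Lim_transform_eventually)
    thus ?thesis ..
  qed
  obtain T where T: "\<And>x. ((\<lambda>r. blinfun_apply (fock_value r i) x) \<longlongrightarrow> blinfun_apply T x) (at_left 1)"
  proof (rule pointwise_limit_on_fock[of "\<lambda>r. fock_value r i" "at_left 1"])
    show "\<forall>\<^sub>F r in at_left 1. norm (fock_value r i) \<le> 1"
      using eventually_at_left_one by eventually_elim (simp add: norm_fock_value)
    show "\<forall>\<^sub>F r in at_left 1. \<forall>c x. blinfun_apply (fock_value r i) (c *\<^sub>C x) = c *\<^sub>C blinfun_apply (fock_value r i) x"
      using eventually_at_left_one by eventually_elim (simp add: fock_value_scaleC)
    show "at_left (1::real) \<noteq> bot" by simp
    show "\<exists>l. ((\<lambda>r. blinfun_apply (fock_value r i) (fock_basis \<alpha>)) \<longlongrightarrow> l) (at_left 1)" for \<alpha>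
      by (rule basis)
  qed (rule that)
  \<comment> \<open>The series and the compressed value agree for \<open>r\<close> in
    \<open>[0, 1)\<close>, which suffices for a left limit at 1.\<close>
  have series: "\<forall>\<^sub>F r in at_left 1. blinfun_apply (fock_value r i) x
      = blinfun_apply (free_series (free_coeff (\<lambda>X. \<phi> X i)) (\<lambda>j. r *\<^sub>R creation j)) x" for x
    using eventually_at_left_one
    by eventually_elim (simp add: free_series_def sums_unique[OF fock_value_sums] coeff_def[symmetric])
  have lim: "limitin strong_operator_topology
      (\<lambda>r. free_series (free_coeff (\<lambda>X. \<phi> X i)) (\<lambda>j. r *\<^sub>R creation j)) S (at_left 1)
      \<longleftrightarrow> (\<forall>x. ((\<lambda>r. blinfun_apply (fock_value r i) x) \<longlongrightarrow> blinfun_apply S x) (at_left 1))" for S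
    unfolding strong_limit_iff using tendsto_cong[OF series] by simp
  have "boundary_function \<phi> i = T"
    unfolding boundary_function_def lim
  proof (rule the_equality)
    fix S assume S: "\<forall>x. ((\<lambda>r. blinfun_apply (fock_value r i) x) \<longlongrightarrow> blinfun_apply S x) (at_left 1)"
    show "S = T"
      using S T tendsto_unique[OF trivial_limit_at_left_real] by (intro blinfun_eqI) blast
  qed (use T in blast)
  thus ?thesis using T by simp
qed

lemma Rep_boundary_vacuum: "Rep_ell2 (blinfun_apply (boundary_function \<phi> i) (fock_basis [])) = coeff i"
proof -
  obtain L where L: "((\<lambda>r. blinfun_apply (fock_value r i) (fock_basis [])) \<longlongrightarrow> L) (at_left 1)"
    and "Rep_ell2 L = coeff i"
    by (rule fock_value_vacuum_limit)
  thus ?thesis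
    using tendsto_unique[OF trivial_limit_at_left_real L fock_value_tendsto_boundary] by simp
qed

lemma norm_row_boundary: "norm (row_op (boundary_function \<phi>)) \<le> 1"
proof (rule norm_blinfun_bound)
  fix v :: "'n fock ^ 'm"
  have "((\<lambda>r. norm (blinfun_apply (row_op (fock_value r)) v))
      \<longlongrightarrow> norm (blinfun_apply (row_op (boundary_function \<phi>)) v)) (at_left 1)"
    unfolding row_op.rep_eq by (intro tendsto_intros fock_value_tendsto_boundary)
  moreover have "\<forall>\<^sub>F r in at_left 1. norm (blinfun_apply (row_op (fock_value r)) v) \<le> 1 * norm v"
    using eventually_at_left_one
  proof eventually_elim
    case (elim r)
    hence "norm (row_op (fock_value r)) * norm v \<le> 1 * norm v"
      by (intro mult_right_mono norm_row_fock_value) auto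
    thus ?case using norm_blinfun[of "row_op (fock_value r)" v] by linarith
  qed
  ultimately show "norm (blinfun_apply (row_op (boundary_function \<phi>)) v) \<le> 1 * norm v"
    by (rule tendsto_upperbound) simp
qed simp

text \<open>A scalar boundary function fixes the vacuum up to a factor, so all coefficients of
  nonempty words vanish. Conversely a constant map compresses to the same scalars for every
  \<open>r\<close>, because \<open>coord_op e\<close> inverts \<open>synth_op e\<close> from the
  left.\<close>

lemma boundary_scalar_iff:
  "boundary_function \<phi> = scalar_tuple c \<longleftrightarrow> (\<forall>X\<in>op_ball. \<phi> X = scalar_tuple c)"
proof
  assume L: "boundary_function \<phi> = scalar_tuple c"
  have coeff: "coeff i \<alpha> = (if \<alpha> = [] then c $ i else 0)" for i \<alpha>
    using fun_cong[OF Rep_boundary_vacuum[of i], of \<alpha>]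
    by (simp add: L scalar_tuple_def scalar_op.rep_eq scaleC_ell2.rep_eq fock_basis.rep_eq split: if_splits)
  show "\<forall>X\<in>op_ball. \<phi> X = scalar_tuple c"
  proof (intro ballI ext)
    fix X :: "'n \<Rightarrow> 'h \<Rightarrow>\<^sub>L 'h" and i assume X: "X \<in> op_ball"
    have "homogeneous_part (coeff i) X k = (if k = 0 then scalar_op (c $ i) else 0)" for k
    proof (cases "k = 0")
      case True
      thus ?thesis by (simp add: homogeneous_part_0 coeff)
    next
      case False
      hence "blinfun_apply (homogeneous_part (coeff i) X k) x = 0" for x
        unfolding homogeneous_part_apply by (intro sum.neutral) (auto simp: coeff)
      thus ?thesis using False by (intro blinfun_eqI) simp
    qed
    hence "homogeneous_part (coeff i) X = (\<lambda>k. if k = 0 then scalar_op (c $ i) else 0)" by blast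
    hence "(\<lambda>k. if k = 0 then scalar_op (c $ i) else 0) sums \<phi> X i"
      using coeff_expands X unfolding expands_def by metis
    from sums_unique2[OF this sums_single[of 0 "\<lambda>_. scalar_op (c $ i)"]]
    show "\<phi> X i = scalar_tuple c i" by (simp add: scalar_tuple_def)
  qed
next
  assume const: "\<forall>X\<in>op_ball. \<phi> X = scalar_tuple c"
  show "boundary_function \<phi> = scalar_tuple c"
  proof (intro ext blinfun_eqI)
    fix i x
    have "\<forall>\<^sub>F r in at_left 1. c $ i *\<^sub>C x = blinfun_apply (fock_value r i) x"
      using eventually_at_left_one
    proof eventually_elim
      case (elim r)
      hence "\<phi> (dilated_creation e r) = scalar_tuple c"
        using const dilated_creation_op_ball[OF e] by blast
      thus ?case
        by (simp add: fock_value_def scalar_tuple_def scalar_op.rep_eq coord_op_scaleC[OF e] coord_synth_op[OF e])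
    qed
    hence "((\<lambda>r. blinfun_apply (fock_value r i) x) \<longlongrightarrow> c $ i *\<^sub>C x) (at_left 1)"
      by (rule Lim_transform_eventually[OF tendsto_const])
    from tendsto_unique[OF trivial_limit_at_left_real fock_value_tendsto_boundary this]
    show "blinfun_apply (boundary_function \<phi> i) x = blinfun_apply (scalar_tuple c i) x"
      by (simp add: scalar_tuple_def scalar_op.rep_eq)
  qed
qed

end

section \<open>Dilations of the map and the four statements\<close>

lemma expands_dilate:
  fixes \<phi> :: "('n::finite \<Rightarrow> 'a \<Rightarrow>\<^sub>L 'a) \<Rightarrow> 'm::finite \<Rightarrow> 'a::complex_hilbert_space \<Rightarrow>\<^sub>L 'a"
  assumes exp: "expands a \<phi>" and r: "0 \<le> r" "r \<le> 1"
  shows "expands (\<lambda>i \<alpha>. complex_of_real (r ^ length \<alpha>) * a i \<alpha>) (\<lambda>X. \<phi> (\<lambda>i. r *\<^sub>R X i))"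
  unfolding expands_def
proof (intro ballI allI)
  fix X :: "'n \<Rightarrow> 'a \<Rightarrow>\<^sub>L 'a" and i
  assume X: "X \<in> op_ball"
  have "homogeneous_part (\<lambda>\<alpha>. complex_of_real (r ^ length \<alpha>) * a i \<alpha>) X k
      = scalar_op (complex_of_real r ^ k) o\<^sub>L homogeneous_part (a i) X k" for k
    by (rule blinfun_eqI)
      (simp add: homogeneous_part_apply scalar_op.rep_eq scaleC_sum scaleC_scaleC)
  moreover have "(\<lambda>k. scalar_op (complex_of_real r ^ k) o\<^sub>L homogeneous_part (a i) X k)
      sums \<phi> (\<lambda>i. r *\<^sub>R X i) i"
    using expands_cscale[OF exp X, of "complex_of_real r"] r by (simp add: scalar_op_of_real_compose)
  ultimately show "homogeneous_part (\<lambda>\<alpha>. complex_of_real (r ^ length \<alpha>) * a i \<alpha>) X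
      sums \<phi> (\<lambda>i. r *\<^sub>R X i) i"
    by (simp add: sums_def)
qed

lemma scaleR_one_op_ball: "X \<in> op_ball \<Longrightarrow> 0 \<le> r \<Longrightarrow> r \<le> 1 \<Longrightarrow> (\<lambda>i. r *\<^sub>R X i) \<in> op_ball"
  using scalar_op_compose_op_ball[of X "complex_of_real r"] by (simp add: scalar_op_of_real_compose)

theorem theorem1p1:
  fixes \<phi> :: "('n::finite \<Rightarrow> 'h::complex_hilbert_space \<Rightarrow>\<^sub>L 'h) \<Rightarrow> 'm::finite \<Rightarrow> 'h \<Rightarrow>\<^sub>L 'h"
  assumes separable: "separable_space (euclidean :: 'h topology)"
    and infinite_dim: "infinite_dimensional TYPE('h)"
    and holo: "free_holomorphic_map \<phi>"
    and maps: "\<phi> ` op_ball \<subseteq> op_cball"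
  shows "(\<phi> ` op_ball \<subseteq> op_ball \<or>
           (\<exists>\<zeta> \<in> frontier (ball (0 :: complex^'m) 1). \<forall>X\<in>op_ball. \<phi> X = scalar_tuple \<zeta>)) \<and>
         (\<phi> constant_on op_ball \<longleftrightarrow> norm (row_op (\<phi> (\<lambda>_. 0))) = sup_norm \<phi>) \<and>
         (\<not> \<phi> constant_on op_ball \<longrightarrow>
           strict_mono_on {0..<1::real} (\<lambda>r. sup_norm (\<lambda>X. \<phi> (\<lambda>i. r *\<^sub>R X i)))) \<and>
         (\<phi> ` op_ball \<subseteq> op_ball \<longleftrightarrow>
           (\<exists>\<zeta> \<in> ball (0 :: complex^'m) 1. boundary_function \<phi> = scalar_tuple \<zeta>) \<or>
           (\<not> (\<exists>c :: complex^'m. boundary_function \<phi> = scalar_tuple c) \<and>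
            norm (row_op (boundary_function \<phi>)) \<le> 1))"
proof -
  obtain e :: "'n list \<Rightarrow> 'h" where e: "orthonormal_family e"
    using orthonormal_family_exists[OF infinite_dim] by blast
  interpret contractive_free_map \<phi> e
    using holo maps e by unfold_locales
  note nonzero = ex_nonzero[OF infinite_dim]
  \<comment> \<open>The point of complex space identified with the value at 0; the whole argument
    branches on its norm.\<close>
  define \<zeta> where "\<zeta> = (\<chi> i. coeff i [])"
  have \<phi>0: "\<phi> (\<lambda>_. 0) = scalar_tuple \<zeta>"
    unfolding \<zeta>_def by (rule expands_zero[OF coeff_expands])
  have norm\<phi>0: "norm (row_op (\<phi> (\<lambda>_. 0))) = norm \<zeta>"
    unfolding \<phi>0 by (rule norm_row_op_scalar_tuple[OF nonzero])
  have \<zeta>1: "norm \<zeta> \<le> 1" using norm_row_le[OF zero_op_ball] norm\<phi>0 by simp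
  \<comment> \<open>The dilated map, with \<open>r = 1\<close> included so that (ii) and (iii) share
    the same extremal argument.\<close>
  define \<psi> where "\<psi> r X = \<phi> (\<lambda>i. r *\<^sub>R X i)" for r :: real and X
  have \<psi>_bound: "norm (row_op (\<psi> r X)) \<le> 1" if "0 \<le> r" "r \<le> 1" "X \<in> op_ball" for r X
    unfolding \<psi>_def using that by (intro norm_row_le scaleR_one_op_ball)
  have sup_upper: "norm (row_op (\<psi> r X)) \<le> sup_norm (\<psi> r)" if "0 \<le> r" "r \<le> 1" "X \<in> op_ball" for r X
    unfolding sup_norm_def using that
    by (intro cSUP_upper bdd_aboveI2[where M = 1] \<psi>_bound) auto
  have \<psi>1: "\<psi> 1 = \<phi>" by (simp add: \<psi>_def fun_eq_iff)
  have \<psi>0: "\<psi> r (\<lambda>_. 0) = scalar_tuple \<zeta>" for r by (simp add: \<psi>_def \<phi>0)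
  have \<psi>_expands: "expands (\<lambda>i \<alpha>. complex_of_real (r ^ length \<alpha>) * coeff i \<alpha>) (\<psi> r)"
    if r: "0 \<le> r" "r \<le> 1" for r
    using expands_dilate[OF coeff_expands r] unfolding \<psi>_def .

  \<comment> \<open>The strict case: Schwarz--Pick with \<open>M = 1\<close> and
    \<open>q = norm \<zeta>\<close>.\<close>
  have dichotomy: "\<phi> ` op_ball \<subseteq> op_ball" if "norm \<zeta> < 1"
  proof (rule image_subsetI)
    fix X :: "'n \<Rightarrow> 'h \<Rightarrow>\<^sub>L 'h" assume X: "X \<in> op_ball"
    obtain t Y where tY: "0 < t" "t < 1" "Y \<in> op_ball" "X = cscale (complex_of_real t) Y"
      using op_ball_dilate[OF X] by blast
    have "norm (row_op (\<phi> (cscale (complex_of_real t) Y))) \<le> pick_bound (norm \<zeta>) t * 1"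
      by (rule expands_pick[OF coeff_expands norm_row_le]) (use tY that norm\<phi>0 in auto)
    also have "\<dots> < 1" using pick_bound_less_one[of "norm \<zeta>" t] tY that by simp
    finally show "\<phi> X \<in> op_ball" using value_in_bounded_ops[OF X] by (simp add: op_ball_iff tY(4))
  qed
  have extremal: "\<forall>X\<in>op_ball. \<psi> r X = scalar_tuple \<zeta>" if "0 \<le> r" "r \<le> 1" "sup_norm (\<psi> r) = norm \<zeta>" for r
    using expands_max_imp_constant[OF \<psi>_expands[OF that(1,2)] sup_upper[OF that(1,2), unfolded that(3)] \<psi>0]
    by blast
  have unit: "\<forall>X\<in>op_ball. \<phi> X = scalar_tuple \<zeta>" if "norm \<zeta> = 1"
    using expands_max_imp_constant[OF coeff_expands norm_row_le[folded that] \<phi>0] by blast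

  have i: "\<phi> ` op_ball \<subseteq> op_ball \<or>
      (\<exists>\<zeta> \<in> frontier (ball (0 :: complex^'m) 1). \<forall>X\<in>op_ball. \<phi> X = scalar_tuple \<zeta>)"
    using dichotomy unit \<zeta>1 by (cases "norm \<zeta> = 1") (auto simp: frontier_ball)
  have ii: "\<phi> constant_on op_ball \<longleftrightarrow> norm (row_op (\<phi> (\<lambda>_. 0))) = sup_norm \<phi>"
  proof
    assume "\<phi> constant_on op_ball"
    then obtain C where "\<And>X. X \<in> op_ball \<Longrightarrow> \<phi> X = C" unfolding constant_on_def by blast
    hence "norm (row_op (\<phi> X)) = norm (row_op (\<phi> (\<lambda>_. 0)))" if "X \<in> op_ball" for X
      by (simp only: that zero_op_ball)
    hence "sup_norm \<phi> = (SUP X\<in>(op_ball :: ('n \<Rightarrow> 'h \<Rightarrow>\<^sub>L 'h) set). norm (row_op (\<phi> (\<lambda>_. 0))))"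
      unfolding sup_norm_def by (rule SUP_cong[OF refl])
    also have "\<dots> = norm (row_op (\<phi> (\<lambda>_. 0)))"
      by (rule cSUP_const) simp
    finally show "norm (row_op (\<phi> (\<lambda>_. 0))) = sup_norm \<phi>" by simp
  next
    assume "norm (row_op (\<phi> (\<lambda>_. 0))) = sup_norm \<phi>"
    thus "\<phi> constant_on op_ball"
      using extremal[of 1] norm\<phi>0 by (auto simp: \<psi>1 constant_on_def)
  qed
  have iii: "strict_mono_on {0..<1::real} (\<lambda>r. sup_norm (\<psi> r))" if nonconst: "\<not> \<phi> constant_on op_ball"
  proof (rule strict_mono_onI)
    fix r s :: real assume "r \<in> {0..<1}" "s \<in> {0..<1}" and rs: "r < s"
    hence r: "0 \<le> r" "r \<le> 1" and s: "0 < s" "0 \<le> s" "s \<le> 1" by auto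
    define M where "M = sup_norm (\<psi> s)"
    have "norm \<zeta> \<le> M"
      using sup_upper[OF s(2,3) zero_op_ball] norm\<phi>0 \<phi>0 by (simp add: \<psi>0 M_def)
    \<comment> \<open>Equality would make the dilation by \<open>s\<close> constant, and by the
      identity theorem also \<open>\<phi>\<close>; here \<open>s > 0\<close> follows from
      \<open>r < s\<close>.\<close>
    moreover have "norm \<zeta> \<noteq> M"
    proof
      assume "norm \<zeta> = M"
      hence "\<phi> (\<lambda>i. s *\<^sub>R X i) = scalar_tuple \<zeta>" if "X \<in> op_ball" for X
        using extremal[OF s(2,3)] that by (auto simp: M_def \<psi>_def)
      hence "\<phi> X = scalar_tuple \<zeta>" if "X \<in> op_ball" for X
        using expands_identity[OF coeff_expands s(1,3)] that by blast
      thus False using nonconst by (auto simp: constant_on_def)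
    qed
    ultimately have M: "norm \<zeta> < M" by simp
    hence "0 < M" using norm_ge_zero[of \<zeta>] by linarith
    define q where "q = norm \<zeta> / M"
    have q: "0 \<le> q" "q < 1" "norm \<zeta> = q * M" using M \<open>0 < M\<close> by (auto simp: q_def)
    \<comment> \<open>Since \<open>r X\<close> is \<open>s\<close> times the tuple
      \<open>(r / s) X\<close>, the map \<open>\<psi> r\<close> is \<open>\<psi> s\<close> shrunk by
      a factor below 1, and Schwarz--Pick for \<open>\<psi> s\<close> gives a uniform gain.\<close>
    have "sup_norm (\<psi> r) \<le> pick_bound q (r / s) * M"
      unfolding sup_norm_def
    proof (rule cSUP_least)
      show "(op_ball :: ('n \<Rightarrow> 'h \<Rightarrow>\<^sub>L 'h) set) \<noteq> {}" by simp
      fix X :: "'n \<Rightarrow> 'h \<Rightarrow>\<^sub>L 'h" assume X: "X \<in> op_ball"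
      have "\<psi> r X = \<psi> s (cscale (complex_of_real (r / s)) X)"
        unfolding \<psi>_def cscale_of_real[symmetric] cscale_cscale using s by simp
      moreover have "norm (row_op (\<psi> s (cscale (complex_of_real (r / s)) X))) \<le> pick_bound q (r / s) * M"
        by (rule expands_pick[OF \<psi>_expands[OF s(2,3)]])
          (use q r rs s X norm\<phi>0 \<phi>0 sup_upper[OF s(2,3)] in \<open>auto simp: \<psi>0 M_def norm_divide\<close>)
      ultimately show "norm (row_op (\<psi> r X)) \<le> pick_bound q (r / s) * M" by simp
    qed
    also have "\<dots> < 1 * M"
      using pick_bound_less_one[of q "r / s"] q r rs s \<open>0 < M\<close> by (intro mult_strict_right_mono) auto
    finally show "sup_norm (\<psi> r) < sup_norm (\<psi> s)" by (simp add: M_def)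
  qed
  have iv: "\<phi> ` op_ball \<subseteq> op_ball \<longleftrightarrow>
      (\<exists>\<zeta> \<in> ball (0 :: complex^'m) 1. boundary_function \<phi> = scalar_tuple \<zeta>) \<or>
      (\<not> (\<exists>c :: complex^'m. boundary_function \<phi> = scalar_tuple c) \<and>
       norm (row_op (boundary_function \<phi>)) \<le> 1)"
  proof
    assume ball: "\<phi> ` op_ball \<subseteq> op_ball"
    have "norm c < 1" if "boundary_function \<phi> = scalar_tuple c" for c :: "complex ^ 'm"
    proof -
      have "\<phi> (\<lambda>_. 0) = scalar_tuple c"
        using that boundary_scalar_iff zero_op_ball by blast
      moreover have "norm (row_op (\<phi> (\<lambda>_. 0))) < 1"
        using ball zero_op_ball op_ball_iff by blast
      ultimately show ?thesis using norm_row_op_scalar_tuple[OF nonzero, of c] by simp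
    qed
    thus "(\<exists>\<zeta> \<in> ball (0 :: complex^'m) 1. boundary_function \<phi> = scalar_tuple \<zeta>) \<or>
      (\<not> (\<exists>c :: complex^'m. boundary_function \<phi> = scalar_tuple c) \<and>
       norm (row_op (boundary_function \<phi>)) \<le> 1)"
      using norm_row_boundary by auto
  next
    assume bd: "(\<exists>\<zeta> \<in> ball (0 :: complex^'m) 1. boundary_function \<phi> = scalar_tuple \<zeta>) \<or>
      (\<not> (\<exists>c :: complex^'m. boundary_function \<phi> = scalar_tuple c) \<and>
       norm (row_op (boundary_function \<phi>)) \<le> 1)"
    \<comment> \<open>For norm 1 the map is constant, so its boundary function is the scalar
      \<open>\<zeta>\<close>. This rules out the second alternative, and the first would place
      \<open>\<zeta>\<close> in the open ball.\<close>
    have "norm \<zeta> \<noteq> 1"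
    proof
      assume one: "norm \<zeta> = 1"
      hence b: "boundary_function \<phi> = scalar_tuple \<zeta>" using unit boundary_scalar_iff by blast
      then obtain c :: "complex ^ 'm" where c: "norm c < 1" "boundary_function \<phi> = scalar_tuple c"
        using bd by auto
      have "\<phi> (\<lambda>_. 0) = scalar_tuple c" using c(2) boundary_scalar_iff zero_op_ball by blast
      hence "c = \<zeta>" using \<phi>0 by (intro scalar_tuple_inject[OF nonzero]) simp
      thus False using c one by simp
    qed
    thus "\<phi> ` op_ball \<subseteq> op_ball" using dichotomy \<zeta>1 by simp
  qed
  show ?thesis
    using i ii iii[unfolded \<psi>_def] iv by (intro conjI impI)
qed

end
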